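(* For every real $x$ with $0<x<1$, $$\gamma_1(x)=\lim_{s\to 0^+}\gamma_1(x,s),$$ where, for real $s>0$, $\gamma_1(x,s)$ is defined by $$\gamma_1(x,s)=\sum_{n=1}^{\infty}\frac{[\gamma+\log(2\pi n)]^2\cos(2\pi nx)}{n^s}-\frac12\zeta(2)\sum_{n=1}^{\infty}\frac{\cos(2\pi nx)}{n^s}-\pi\sum_{n=1}^{\infty}\frac{[\gamma+\log(2\pi n)]\sin(2\pi nx)}{n^s}.$$
   Context: $\gamma$ is Euler's constant and $\zeta$ is the Riemann zeta function. For $x>0$ the Hurwitz zeta function is $\zeta(s,x)=\sum_{n=0}^\infty (n+x)^{-s}$ for $\operatorname{Re}(s)>1$, extended by analytic continuation to $s\neq 1$. The generalised Stieltjes constants $\gamma_n(x)$ are the coefficients in the Laurent expansion about $s=1$: $$\zeta(s,x)=\frac{1}{s-1}+\sum_{n=0}^\infty\frac{(-1)^n}{n!}\gamma_n(x)(s-1)^n .$$ For $0<x<1$ and $s>0$ the trigonometric series in the claim are understood as (in general conditionally) convergent series, i.e. limits of their partial sums. *)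

theory Defs
  imports "HOL-Complex_Analysis.Complex_Analysis"
begin

(* hurwitz_zeta x is the function s |-> zeta(s, x), meaningful for x > 0. By the identity theorem
   a holomorphic continuation of the series to the connected set - {1} is unique there; the
   value 0 at the pole is a convention that only serves to make the description definite. *)
definition hurwitz_zeta :: "real \<Rightarrow> complex \<Rightarrow> complex" where
  "hurwitz_zeta x =
     (THE f. f holomorphic_on (- {1}) \<and>
             (\<forall>s. Re s > 1 \<longrightarrow> (\<lambda>n. (of_nat n + of_real x) powr (- s)) sums f s) \<and>
             f 1 = 0)"

definition riemann_zeta :: "complex \<Rightarrow> complex" where
  "riemann_zeta = hurwitz_zeta 1"

(* The coefficient of (s - 1)^n in the Laurent expansion at 1 is (-1)^n / n! * gamma_n(x). *)
definition stieltjes_gamma :: "nat \<Rightarrow> real \<Rightarrow> complex" where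
  "stieltjes_gamma n x =
     (- 1) ^ n * fact n * fls_nth (laurent_expansion (hurwitz_zeta x) 1) (int n)"

(* Each suminf is the limit of the partial sums in the natural order, so conditional convergence
   is covered; the index is shifted because the series start at n = 1. *)
definition cos_log_sq_series :: "real \<Rightarrow> real \<Rightarrow> real" where
  "cos_log_sq_series x s =
     (\<Sum>k. let n = real (Suc k)
           in (euler_mascheroni + ln (2 * pi * n))\<^sup>2 * cos (2 * pi * n * x) / n powr s)"

definition cos_series :: "real \<Rightarrow> real \<Rightarrow> real" where
  "cos_series x s = (\<Sum>k. let n = real (Suc k) in cos (2 * pi * n * x) / n powr s)"

definition sin_log_series :: "real \<Rightarrow> real \<Rightarrow> real" where
  "sin_log_series x s =
     (\<Sum>k. let n = real (Suc k)
           in (euler_mascheroni + ln (2 * pi * n)) * sin (2 * pi * n * x) / n powr s)"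

definition gamma1_reg :: "real \<Rightarrow> real \<Rightarrow> complex" where
  "gamma1_reg x s =
     of_real (cos_log_sq_series x s)
       - 1 / 2 * riemann_zeta 2 * of_real (cos_series x s)
       - of_real (pi * sin_log_series x s)"

end

theory Submission
  imports Defs
begin

text \<open>
  The proof rests on Hurwitz's formula in a form that is regular at s = 0.  For
  z = exp(2 pi i x) write F(z, s) for the sum of z^n n^(-s).  Summing by parts twice
  replaces n^(-s) by its second differences and shows that F(z, s) is holomorphic in
  Re s > -1, a region that contains s = 0.  Hurwitz's formula then says

    s \<zeta>(1 - s, x) = \<Gamma>(1 + s) (2 pi)^(-s) (e^(-i pi s / 2) F(z, s) + e^(i pi s / 2) F(1/z, s)).

  The right-hand side, called hurwitz_phi x below, is holomorphic at 0.  Comparing Laurent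
  expansions, \<gamma>_1(x) is its second Taylor coefficient at 0 (stieltjes_gamma_1_eq).
  The product rule, together with \<Gamma>'(1) = -\<gamma> and \<Gamma>''(1) = \<gamma>^2 + pi^2/6, writes
  this coefficient in terms of F, F' and F'' at s = 0 (deriv2_hurwitz_phi).  For s > 0 the
  Dirichlet series may be differentiated termwise, which brings down factors -log n, and
  the very same expression in F, F' and F'' at the point s is \<gamma>_1(x, s)
  (gamma1_reg_eq).  The limit s \<rightarrow> 0 is now the continuity of F and its derivatives at 0.

  Hurwitz's formula itself is proved for real s between -1 and 0, where the series for
  \<zeta>(1 - s, x) converges absolutely.  There \<Gamma>(1 + s) F(z, s) is the Mellin transform of
  u / (1 - u)^2 with u = z e^(-t): this follows by expanding in powers of u for
  |z| < 1 and letting z approach the circle (has_bochner_integral_periodic_zeta).  On the other hand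
  u / (1 - u)^2 is the sum of 1 / (t - 2 pi i (x + k))^2 over all integers k, because the
  reflection formula of \<Gamma> yields that of the trigamma function
  (kernel_partial_fractions).  Each partial fraction has an explicit Mellin transform, and
  summing over k >= 0 and k < 0 separately produces \<zeta>(1 - s, x) and \<zeta>(1 - s, 1 - x)
  (periodic_zeta_conv_Hurwitz_series).  The formulas for x and 1 - x are two
  linear equations for these two values; solving them is Hurwitz's formula
  (Hurwitz_formula_strip).

  Besides proving the limit, the formula supplies the analytic continuation of
  \<zeta>(s, x) for 0 < x < 1, and hence identifies the function that hurwitz_zeta x
  describes.  The argument x = 1, at which riemann_zeta 2 is evaluated, is obtained from
  x = 1/2 by separating even and odd integers.
\<close>

section \<open>The periodic zeta function\<close>

text \<open>
  The term n = 0 is right as well: 0 powr (-s) = 0 is the coefficient that the series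
  of z^n n^(-s), which starts at n = 1, has at 0.
\<close>

definition powr_second_diff :: "complex \<Rightarrow> nat \<Rightarrow> complex" where
  "powr_second_diff s n = of_nat (n + 2) powr (-s) - 2 * of_nat (n + 1) powr (-s) + of_nat n powr (-s)"

text \<open>
  This is the polylogarithm of order s at z.  Multiplying the series of z^n n^(-s) by
  (1 - z)^2 replaces its coefficients by their second differences, which are
  O(n^(-Re s - 2)).  The form chosen here therefore converges absolutely for Re s > -1,
  up to the boundary |z| = 1 with the exception of z = 1.
\<close>

definition periodic_zeta :: "complex \<Rightarrow> complex \<Rightarrow> complex" where
  "periodic_zeta z s = (z + (\<Sum>n. z ^ (n + 2) * powr_second_diff s n)) / (1 - z)\<^sup>2"

lemma norm_powr_diff_le:
  fixes a :: complex
  assumes "0 < m" "m \<le> y" "Re a \<ge> -1"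
  shows   "norm (of_real (y + 1) powr (-a) - of_real y powr (-a)) \<le> norm a * m powr (-Re a - 1)"
proof -
  have "norm (of_real (y + 1) powr (-a) - of_real y powr (-a))
          \<le> norm a * m powr (-Re a - 1) * norm (of_real (y + 1) - of_real y :: complex)"
  proof (rule field_differentiable_bound)
    show "convex (complex_of_real ` {y..y+1})"
      by (intro convex_linear_image) (auto simp: linear_iff scaleR_conv_of_real)
  next
    fix w assume "w \<in> complex_of_real ` {y..y+1}"
    then obtain u where u: "w = of_real u" "u \<ge> y" by auto
    show "((\<lambda>w. w powr (-a)) has_field_derivative (-a * w powr (-a - 1)))
            (at w within complex_of_real ` {y..y+1})"
      by (rule has_field_derivative_at_within, use u assms in \<open>auto intro!: derivative_eq_intros\<close>)
    have "u powr (-Re a - 1) \<le> m powr (-Re a - 1)"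
      using u assms by (intro powr_mono2') auto
    thus "norm (-a * w powr (-a - 1)) \<le> norm a * m powr (-Re a - 1)"
      using u assms by (auto simp: norm_mult norm_powr_real_powr intro!: mult_left_mono)
  qed (intro imageI, simp)+
  thus ?thesis by simp
qed

text \<open>
  By two applications of the mean value inequality, a second difference is at most the
  maximum of the second derivative s (s + 1) y^(-s - 2).
\<close>

lemma norm_powr_second_diff_le:
  assumes "n > 0" "Re s \<ge> -2"
  shows   "norm (powr_second_diff s n) \<le> norm s * norm (s + 1) * real n powr (-Re s - 2)"
proof -
  \<comment> \<open>The second difference is the increment of G, and G' is again a first difference.\<close>
  define G where "G = (\<lambda>w. (w + 1) powr (-s) - w powr (-s))"
  define B where "B = norm (s + 1) * real n powr (-Re s - 2)"
  have "norm (G (of_real (real n + 1)) - G (of_real (real n)))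
          \<le> norm s * B * norm (of_real (real n + 1) - of_real (real n) :: complex)"
  proof (rule field_differentiable_bound)
    show "convex (complex_of_real ` {real n..real n+1})"
      by (intro convex_linear_image) (auto simp: linear_iff scaleR_conv_of_real)
  next
    fix w assume "w \<in> complex_of_real ` {real n..real n+1}"
    then obtain u where u: "w = of_real u" "u \<ge> real n" by auto
    have w1: "w + 1 = of_real (u + 1)" by (simp add: u)
    have nonneg: "of_real (u + 1) \<notin> \<real>\<^sub>\<le>\<^sub>0" "of_real u \<notin> \<real>\<^sub>\<le>\<^sub>0"
      using u assms by (auto simp del: of_real_add)
    show "(G has_field_derivative (-s * ((w + 1) powr (-(s + 1)) - w powr (-(s + 1)))))
            (at w within complex_of_real ` {real n..real n+1})"
      unfolding G_def
      by (rule has_field_derivative_at_within)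
         (use nonneg w1 u(1) in \<open>auto intro!: derivative_eq_intros simp: algebra_simps minus_diff_commute\<close>)
    have "norm ((w + 1) powr (-(s + 1)) - w powr (-(s + 1))) \<le> B"
      using norm_powr_diff_le[of "real n" u "s + 1"] u w1 assms by (simp add: B_def algebra_simps)
    thus "norm (-s * ((w + 1) powr (-(s + 1)) - w powr (-(s + 1)))) \<le> norm s * B"
      by (auto simp: norm_mult intro!: mult_left_mono)
  qed (intro imageI, simp)+
  moreover have "G (of_real (real n + 1)) - G (of_real (real n)) = powr_second_diff s n"
    by (simp add: G_def powr_second_diff_def algebra_simps)
  ultimately show ?thesis by (simp add: B_def mult_ac)
qed

text \<open>
  A majorant that does not depend on s near a given point, as the M-test requires.
\<close>

lemma powr_second_diff_locally_bounded:
  assumes "Re s0 > -1"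
  obtains d C e where "d > 0" "C \<ge> 0" "e > 1" "cball s0 d \<subseteq> {s. Re s > -1}"
    "\<And>s n. s \<in> cball s0 d \<Longrightarrow> n > 0 \<Longrightarrow> norm (powr_second_diff s n) \<le> C * real n powr (-e)"
proof
  define d where "d = (Re s0 + 1) / 2"
  define e where "e = (Re s0 + 3) / 2"
  define C where "C = (norm s0 + d) * (norm s0 + d + 1)"
  show "d > 0" "C \<ge> 0" "e > 1" using assms by (auto simp: d_def e_def C_def)
  have re: "Re s \<ge> Re s0 - d" if "s \<in> cball s0 d" for s
    using that abs_Re_le_cmod[of "s0 - s"] by (auto simp: dist_norm)
  show "cball s0 d \<subseteq> {s. Re s > -1}"
  proof
    fix s assume "s \<in> cball s0 d"
    with re[of s] assms show "s \<in> {s. Re s > -1}"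
      by (auto simp: d_def field_simps)
  qed
  fix s n assume s: "s \<in> cball s0 d" and n: "n > (0::nat)"
  have ns: "norm s \<le> norm s0 + d"
    using s norm_triangle_ineq2[of s s0] by (auto simp: dist_norm norm_minus_commute)
  have ns1: "norm (s + 1) \<le> norm s0 + d + 1"
    using ns norm_triangle_ineq[of s 1] by simp
  have ex: "-Re s - 2 \<le> -e" using re[OF s] by (simp add: d_def e_def field_simps)
  have "norm (powr_second_diff s n) \<le> norm s * norm (s + 1) * real n powr (-Re s - 2)"
    using n re[OF s] assms by (intro norm_powr_second_diff_le) (auto simp: d_def field_simps)
  also have "\<dots> \<le> C * real n powr (-e)"
    unfolding C_def using ns ns1 ex n \<open>d > 0\<close>
    by (intro mult_mono powr_mono) auto
  finally show "norm (powr_second_diff s n) \<le> C * real n powr (-e)" .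
qed

lemma norm_power_le_1:
  fixes z :: complex
  shows "norm z \<le> 1 \<Longrightarrow> norm (z ^ k) \<le> 1"
  by (simp add: norm_power power_le_one)

lemma holomorphic_powr_second_diff [holomorphic_intros]: "(\<lambda>s. powr_second_diff s n) holomorphic_on A"
proof -
  have "(\<lambda>s. of_nat k powr (-s)) holomorphic_on A" for k :: nat
    by (cases "k = 0") (auto intro!: holomorphic_intros)
  from this[of n] this[of "n+1"] this[of "n+2"] show ?thesis
    unfolding powr_second_diff_def by (intro holomorphic_intros) 
qed

lemma uniform_limit_second_diff_series:
  assumes "norm z \<le> 1" "Re s0 > -1"
  shows "\<exists>d>0. cball s0 d \<subseteq> {s. Re s > -1} \<and>
           uniform_limit (cball s0 d) (\<lambda>N s. \<Sum>n<N. z ^ (n + 2) * powr_second_diff s n)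
             (\<lambda>s. \<Sum>n. z ^ (n + 2) * powr_second_diff s n) sequentially"
proof -
  obtain d C e where d: "d > 0" "C \<ge> 0" "e > 1" "cball s0 d \<subseteq> {s. Re s > -1}"
    and bd: "\<And>s n. s \<in> cball s0 d \<Longrightarrow> n > 0 \<Longrightarrow> norm (powr_second_diff s n) \<le> C * real n powr (-e)"
    using powr_second_diff_locally_bounded[OF assms(2)] by metis
  have "uniform_limit (cball s0 d) (\<lambda>N s. \<Sum>n<N. z ^ (n + 2) * powr_second_diff s n)
             (\<lambda>s. \<Sum>n. z ^ (n + 2) * powr_second_diff s n) sequentially"
  proof (rule Weierstrass_m_test_ev)
    show "\<forall>\<^sub>F n in sequentially. \<forall>s\<in>cball s0 d.
            norm (z ^ (n + 2) * powr_second_diff s n) \<le> C * real n powr (-e)"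
      using eventually_gt_at_top[of 0]
    proof eventually_elim
      case (elim n)
      show ?case
      proof
        fix s assume s: "s \<in> cball s0 d"
        have "norm (z ^ (n + 2) * powr_second_diff s n) \<le> 1 * (C * real n powr (-e))"
          unfolding norm_mult using d
          by (intro mult_mono norm_power_le_1 assms bd s elim) auto
        thus "norm (z ^ (n + 2) * powr_second_diff s n) \<le> C * real n powr (-e)" by simp
      qed
    qed
    show "summable (\<lambda>n. C * real n powr (-e))"
      using d by (intro summable_mult) (simp add: summable_real_powr_iff)
  qed
  with d show ?thesis by blast
qed

lemma second_diff_series_sums:
  assumes "norm z \<le> 1" "Re s > -1"
  shows "(\<lambda>n. z ^ (n + 2) * powr_second_diff s n) sums (\<Sum>n. z ^ (n + 2) * powr_second_diff s n)"
proof -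
  obtain d where "d > 0" "uniform_limit (cball s d) (\<lambda>N s. \<Sum>n<N. z ^ (n + 2) * powr_second_diff s n)
             (\<lambda>s. \<Sum>n. z ^ (n + 2) * powr_second_diff s n) sequentially"
    using uniform_limit_second_diff_series[OF assms] by blast
  from tendsto_uniform_limitI[OF this(2), of s] \<open>d > 0\<close> show ?thesis
    by (simp add: sums_def)
qed

lemma holomorphic_periodic_zeta:
  assumes "norm z \<le> 1" "z \<noteq> 1"
  shows "periodic_zeta z holomorphic_on {s. Re s > -1}"
proof -
  have "(\<lambda>s. \<Sum>n. z ^ (n + 2) * powr_second_diff s n) holomorphic_on {s. Re s > -1}"
  proof (rule holomorphic_uniform_sequence)
    show "open {s. Re s > -1}" by (simp add: open_halfspace_Re_gt)
    show "(\<lambda>s. \<Sum>n<N. z ^ (n + 2) * powr_second_diff s n) holomorphic_on {s. Re s > -1}" for N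
      by (intro holomorphic_intros)
  qed (use uniform_limit_second_diff_series assms in auto)
  thus ?thesis unfolding periodic_zeta_def using assms by (intro holomorphic_intros) auto
qed

text \<open>
  Summation by parts, twice.  The last two summands are the boundary terms; whether they
  vanish in the limit decides where the original Dirichlet series represents
  periodic_zeta.
\<close>

lemma sum_power_powr_second_diff:
  fixes z :: complex
  shows "(1 - z)\<^sup>2 * (\<Sum>n<N+2. z ^ n * of_nat n powr (-s)) = z + (\<Sum>n<N. z ^ (n + 2) * powr_second_diff s n) + 
     z ^ (N + 2) * (of_nat N powr (-s) - 2 * of_nat (N + 1) powr (-s)) + z ^ (N + 3) * of_nat (N + 1) powr (-s)"
proof (induction N)
  case 0
  show ?case by (simp add: powr_second_diff_def algebra_simps power2_eq_square eval_nat_numeral)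
next
  case (Suc N)
  have "(1 - z)\<^sup>2 * (\<Sum>n<Suc N+2. z ^ n * of_nat n powr (-s)) = 
     (1 - z)\<^sup>2 * (\<Sum>n<N+2. z ^ n * of_nat n powr (-s)) + (1 - z)\<^sup>2 * z ^ (N + 2) * of_nat (N + 2) powr (-s)"
    by (simp add: algebra_simps)
  also note Suc.IH
  finally show ?case
    by (simp only:) (simp add: powr_second_diff_def algebra_simps power2_eq_square eval_nat_numeral)
qed


lemma norm_of_nat_powr: "norm (of_nat n powr s :: complex) = real n powr Re s"
  using norm_powr_real_powr[of "of_nat n" s] by (cases "n = 0") auto

lemma norm_power_powr_le:
  assumes "norm z \<le> 1"
  shows   "norm (z ^ k * of_nat n powr (-s)) \<le> real n powr (-Re s)"
proof -
  have "norm (z ^ k * of_nat n powr (-s)) \<le> 1 * real n powr (-Re s)"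
    unfolding norm_mult
    by (intro mult_mono norm_power_le_1 assms) (auto simp: norm_of_nat_powr)
  thus ?thesis by simp
qed

text \<open>
  On the circle the series converges only conditionally when 0 < Re s <= 1, but the boundary terms of the
  summation by parts are O(N^(-Re s)) uniformly near s0.  Locally uniform convergence of
  holomorphic functions is what makes termwise differentiation legitimate.
\<close>

lemma uniform_limit_periodic_zeta:
  assumes "norm z \<le> 1" "z \<noteq> 1" "Re s0 > 0"
  shows "\<exists>d>0. uniform_limit (ball s0 d) (\<lambda>N s. \<Sum>n<N. z ^ n * of_nat n powr (-s))
             (periodic_zeta z) sequentially"
proof -
  obtain d where d: "d > 0" and lim: "uniform_limit (cball s0 d) (\<lambda>N s. \<Sum>n<N. z ^ (n + 2) * powr_second_diff s n)
             (\<lambda>s. \<Sum>n. z ^ (n + 2) * powr_second_diff s n) sequentially"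
    using uniform_limit_second_diff_series[of z s0] assms by auto
  define d' where "d' = min d (Re s0 / 2)"
  have d': "d' > 0" "d' \<le> d" using d assms by (auto simp: d'_def)
  have re: "Re s \<ge> Re s0 / 2" if "s \<in> ball s0 d'" for s
    using that abs_Re_le_cmod[of "s0 - s"] by (auto simp: dist_norm d'_def min_def split: if_splits)
  define E where "E = (\<lambda>N s. z ^ (N + 2) * (of_nat N powr (-s) - 2 * of_nat (N + 1) powr (-s)) 
       + z ^ (N + 3) * of_nat (N + 1) powr (-s))"
  have "uniform_limit (ball s0 d') E (\<lambda>_. 0) sequentially"
  proof (rule uniform_limit_null_comparison)
    show "\<forall>\<^sub>F N in sequentially. \<forall>s\<in>ball s0 d'. norm (E N s) \<le> 4 * real N powr (-(Re s0 / 2))"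
      using eventually_gt_at_top[of 0]
    proof eventually_elim
      case (elim N)
      show ?case
      proof
        fix s assume s: "s \<in> ball s0 d'"
        have le: "real M powr (-Re s) \<le> real N powr (-(Re s0 / 2))" if "M \<ge> N" for M
        proof -
          have "real M powr (-Re s) \<le> real M powr (-(Re s0 / 2))"
            using re[OF s] elim that by (intro powr_mono) auto
          also have "\<dots> \<le> real N powr (-(Re s0 / 2))"
            using elim that assms by (intro powr_mono2') auto
          finally show ?thesis .
        qed
        have "E N s = z ^ (N+2) * of_nat N powr (-s) - z ^ (N+2) * of_nat (N+1) powr (-s)
                - z ^ (N+2) * of_nat (N+1) powr (-s) + z ^ (N + 3) * of_nat (N + 1) powr (-s)"
          by (simp add: E_def algebra_simps)
        also have "norm \<dots> \<le> norm (z ^ (N+2) * of_nat N powr (-s)) + norm (z ^ (N+2) * of_nat (N+1) powr (-s))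
                + norm (z ^ (N+2) * of_nat (N+1) powr (-s)) + norm (z ^ (N + 3) * of_nat (N + 1) powr (-s))"
          by (intro norm_triangle_mono[OF order.trans[OF norm_triangle_ineq4]] add_mono
                order.trans[OF norm_triangle_ineq4] order.refl norm_triangle_ineq4)
        also have "\<dots> \<le> real N powr (-Re s) + real (N+1) powr (-Re s) + real (N+1) powr (-Re s) + real (N+1) powr (-Re s)"
          by (intro add_mono norm_power_powr_le assms)
        also have "\<dots> \<le> 4 * real N powr (-(Re s0 / 2))"
          using le[of N] le[of "N+1"] by simp
        finally show "norm (E N s) \<le> 4 * real N powr (-(Re s0 / 2))" .
      qed
    qed
    have "((\<lambda>N. 4 * real N powr (-(Re s0 / 2))) \<longlongrightarrow> 4 * 0) sequentially"
      using assms by (intro tendsto_intros tendsto_neg_powr filterlim_real_sequentially) auto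
    thus "uniform_limit (ball s0 d') (\<lambda>N _. 4 * real N powr (-(Re s0 / 2))) (\<lambda>_. 0) sequentially"
      by (auto intro!: uniform_limitI order_tendstoD simp: dist_norm tendsto_iff)
  qed
  moreover have "uniform_limit (ball s0 d') (\<lambda>N s. \<Sum>n<N. z ^ (n + 2) * powr_second_diff s n)
             (\<lambda>s. \<Sum>n. z ^ (n + 2) * powr_second_diff s n) sequentially"
    using lim d' by (rule_tac uniform_limit_on_subset) auto
  ultimately have "uniform_limit (ball s0 d') (\<lambda>N s. ((z + (\<Sum>n<N. z ^ (n + 2) * powr_second_diff s n)) + E N s) * (1 / (1 - z)\<^sup>2))
             (\<lambda>s. ((z + (\<Sum>n. z ^ (n + 2) * powr_second_diff s n)) + 0) * (1 / (1 - z)\<^sup>2)) sequentially"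
    by (intro bounded_linear.uniform_limit[OF bounded_linear_mult_left] uniform_limit_intros)
  also have "(\<lambda>s. ((z + (\<Sum>n. z ^ (n + 2) * powr_second_diff s n)) + 0) * (1 / (1 - z)\<^sup>2)) = periodic_zeta z"
    by (simp add: fun_eq_iff periodic_zeta_def)
  also have "(\<lambda>N s. ((z + (\<Sum>n<N. z ^ (n + 2) * powr_second_diff s n)) + E N s) * (1 / (1 - z)\<^sup>2)) =
        (\<lambda>N s. \<Sum>n<N+2. z ^ n * of_nat n powr (-s))"
    using assms sum_power_powr_second_diff[of z _]
    by (auto simp: fun_eq_iff E_def field_simps)
  finally have "uniform_limit (ball s0 d') (\<lambda>N s. \<Sum>n<N. z ^ n * of_nat n powr (-s)) (periodic_zeta z) sequentially"
    unfolding add_2_eq_Suc'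
    by (rule iffD1[OF filterlim_sequentially_Suc, OF iffD1[OF filterlim_sequentially_Suc]])
  with d' show ?thesis by blast
qed

lemma higher_deriv_Dirichlet_partial_sum:
  fixes z :: complex
  shows "(deriv ^^ m) (\<lambda>s. \<Sum>n<N. z ^ n * of_nat n powr (-s)) =
           (\<lambda>s. \<Sum>n<N. z ^ n * of_real (-ln (real n)) ^ m * of_nat n powr (-s))"
proof (induction m)
  case (Suc m)
  have "((\<lambda>s. \<Sum>n<N. z ^ n * of_real (-ln (real n)) ^ m * of_nat n powr (-s)) has_field_derivative
          (\<Sum>n<N. z ^ n * of_real (-ln (real n)) ^ Suc m * of_nat n powr (-s))) (at s)" for s
  proof (rule DERIV_sum)
    fix n
    show "((\<lambda>s. z ^ n * of_real (-ln (real n)) ^ m * of_nat n powr (-s)) has_field_derivative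
          (z ^ n * of_real (-ln (real n)) ^ Suc m * of_nat n powr (-s))) (at s)"
    proof (cases "n = 0")
      case False
      hence "Ln (of_nat n) = of_real (ln (real n))"
        using Ln_of_real[of "real n"] by simp
      hence "((\<lambda>s. of_nat n powr (-s)) has_field_derivative of_real (-ln (real n)) * of_nat n powr (-s)) (at s)"
        using DERIV_chain2[where f = "\<lambda>u. of_nat n powr u" and g = uminus and x = s and s = UNIV,
                OF has_field_derivative_powr_right[of "of_nat n :: complex" "-s"] DERIV_minus[OF DERIV_ident]] False
        by simp
      from DERIV_cmult[OF this, of "z ^ n * of_real (-ln (real n)) ^ m"] show ?thesis
        by (simp add: mult_ac)
    qed auto
  qed
  hence "deriv (\<lambda>s. \<Sum>n<N. z ^ n * of_real (-ln (real n)) ^ m * of_nat n powr (-s)) =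
           (\<lambda>s. \<Sum>n<N. z ^ n * of_real (-ln (real n)) ^ Suc m * of_nat n powr (-s))"
    by (intro ext DERIV_imp_deriv)
  thus ?case by (simp only: funpow.simps o_def Suc.IH)
qed auto

text \<open>
  The source of the logarithms in the theorem: every derivative in s multiplies the n-th
  term by -log n.  The term n = 0 vanishes since 0 powr (-s) = 0.
\<close>

lemma higher_deriv_periodic_zeta_sums:
  assumes "norm z \<le> 1" "z \<noteq> 1" "Re s > 0"
  shows "(\<lambda>n. z ^ n * of_real (-ln (real n)) ^ m * of_nat n powr (-s)) sums (deriv ^^ m) (periodic_zeta z) s"
proof -
  obtain d where d: "d > 0" "uniform_limit (ball s d) (\<lambda>N s. \<Sum>n<N. z ^ n * of_nat n powr (-s))
             (periodic_zeta z) sequentially"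
    using uniform_limit_periodic_zeta[OF assms] by blast
  have "(\<lambda>N. (deriv ^^ m) (\<lambda>s. \<Sum>n<N. z ^ n * of_nat n powr (-s)) s) \<longlonglongrightarrow> (deriv ^^ m) (periodic_zeta z) s"
  proof (rule higher_deriv_complex_uniform_limit[OF d(2)])
    have "(\<lambda>s. of_nat k powr (-s)) holomorphic_on A" for k :: nat and A
      by (cases "k = 0") (auto intro!: holomorphic_intros)
    thus "\<forall>\<^sub>F N in sequentially. (\<lambda>s. \<Sum>n<N. z ^ n * of_nat n powr (-s)) holomorphic_on ball s d"
      by (intro always_eventually allI holomorphic_intros)
  qed (use d in auto)
  thus ?thesis unfolding higher_deriv_Dirichlet_partial_sum sums_def .
qed

text \<open>
  Inside the disc the boundary terms decay geometrically, so that the series is available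
  for all Re s > -1 and not only for Re s > 0.
\<close>

lemma periodic_zeta_sums_in_disc:
  assumes "norm z < 1" "Re s > -1"
  shows "(\<lambda>n. z ^ n * of_nat n powr (-s)) sums periodic_zeta z s"
proof -
  have *: "(\<lambda>N. z ^ N * of_nat N powr (-s)) \<longlonglongrightarrow> 0"
  proof (rule Lim_null_comparison)
    show "\<forall>\<^sub>F N in sequentially. norm (z ^ N * of_nat N powr (-s)) \<le> norm (of_nat N * z ^ N)"
      using eventually_gt_at_top[of 0]
    proof eventually_elim
      case (elim N)
      have "real N powr (-Re s) \<le> real N powr 1"
        using elim assms by (intro powr_mono) auto
      thus ?case using elim
        by (simp add: norm_mult norm_of_nat_powr mult.commute[of "real N"] mult_left_mono)
    qed
    show "(\<lambda>N. norm (of_nat N * z ^ N)) \<longlonglongrightarrow> 0"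
      using powser_times_n_limit_0[OF assms(1)] tendsto_norm_zero by blast
  qed
  have **: "(\<lambda>N. z ^ (N + 1) * of_nat (N + 1) powr (-s)) \<longlonglongrightarrow> 0"
    using LIMSEQ_ignore_initial_segment[OF *, of 1] by simp
  have "(\<lambda>N. ((z + (\<Sum>n<N. z ^ (n + 2) * powr_second_diff s n)) + 
            z\<^sup>2 * (z ^ N * of_nat N powr (-s)) - 2 * z * (z ^ (N + 1) * of_nat (N + 1) powr (-s))
             + z ^ 2 * (z ^ (N + 1) * of_nat (N + 1) powr (-s))) / (1 - z)\<^sup>2)
         \<longlonglongrightarrow> (z + (\<Sum>n. z ^ (n + 2) * powr_second_diff s n) + z\<^sup>2 * 0 - 2 * z * 0 + z\<^sup>2 * 0) / (1 - z)\<^sup>2"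
    using assms second_diff_series_sums[of z s] 
    by (intro tendsto_intros * **) (auto simp: sums_def)
  also have "(\<lambda>N. ((z + (\<Sum>n<N. z ^ (n + 2) * powr_second_diff s n)) + 
            z\<^sup>2 * (z ^ N * of_nat N powr (-s)) - 2 * z * (z ^ (N + 1) * of_nat (N + 1) powr (-s))
             + z ^ 2 * (z ^ (N + 1) * of_nat (N + 1) powr (-s))) / (1 - z)\<^sup>2)
       = (\<lambda>N. \<Sum>n<N+2. z ^ n * of_nat n powr (-s))"
  proof
    fix N
    have nz: "1 - z \<noteq> 0" using assms by auto
    have "(z + (\<Sum>n<N. z ^ (n + 2) * powr_second_diff s n)) + 
            z\<^sup>2 * (z ^ N * of_nat N powr (-s)) - 2 * z * (z ^ (N + 1) * of_nat (N + 1) powr (-s))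
             + z ^ 2 * (z ^ (N + 1) * of_nat (N + 1) powr (-s))
           = (1 - z)\<^sup>2 * (\<Sum>n<N+2. z ^ n * of_nat n powr (-s))"
      unfolding sum_power_powr_second_diff by (simp add: algebra_simps eval_nat_numeral)
    thus "((z + (\<Sum>n<N. z ^ (n + 2) * powr_second_diff s n)) + 
            z\<^sup>2 * (z ^ N * of_nat N powr (-s)) - 2 * z * (z ^ (N + 1) * of_nat (N + 1) powr (-s))
             + z ^ 2 * (z ^ (N + 1) * of_nat (N + 1) powr (-s))) / (1 - z)\<^sup>2
           = (\<Sum>n<N+2. z ^ n * of_nat n powr (-s))"
      using nz by (simp only: nonzero_mult_div_cancel_left[OF power_not_zero[OF nz]])
  qed
  also have "(z + (\<Sum>n. z ^ (n + 2) * powr_second_diff s n) + z\<^sup>2 * 0 - 2 * z * 0 + z\<^sup>2 * 0) / (1 - z)\<^sup>2 = periodic_zeta z s"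
    by (simp add: periodic_zeta_def)
  finally show ?thesis
    unfolding sums_def add_2_eq_Suc'
    by (rule iffD1[OF filterlim_sequentially_Suc, OF iffD1[OF filterlim_sequentially_Suc]])
qed

text \<open>
  Abel's limit theorem for this function: the majorant of the second differences is
  independent of u, so Tannery's theorem applies.
\<close>

lemma tendsto_periodic_zeta:
  assumes "\<And>k. norm (u k) \<le> 1" "u \<longlonglongrightarrow> z" "z \<noteq> 1" "Re s > -1"
  shows "(\<lambda>k. periodic_zeta (u k) s) \<longlonglongrightarrow> periodic_zeta z s"
proof -
  obtain d C e where d: "d > 0" "C \<ge> 0" "e > 1" "cball s d \<subseteq> {s. Re s > -1}"
    and bd: "\<And>s' n. s' \<in> cball s d \<Longrightarrow> n > 0 \<Longrightarrow> norm (powr_second_diff s' n) \<le> C * real n powr (-e)"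
    using powr_second_diff_locally_bounded[OF assms(4)] by metis
  have "(\<lambda>k. \<Sum>n. u k ^ (n + 2) * powr_second_diff s n) \<longlonglongrightarrow> (\<Sum>n. z ^ (n + 2) * powr_second_diff s n)"
  proof (rule conjunct2[OF conjunct2[OF tannerys_theorem]])
    show "(\<lambda>k. u k ^ (n + 2) * powr_second_diff s n) \<longlonglongrightarrow> z ^ (n + 2) * powr_second_diff s n" for n
      by (intro tendsto_intros assms)
    have "\<forall>\<^sub>F x in sequentially \<times>\<^sub>F sequentially. fst x > (0 :: nat) \<and> snd x \<ge> (0 :: nat)"
      by (intro eventually_prodI eventually_gt_at_top eventually_ge_at_top)
    thus "\<forall>\<^sub>F (n, k) in sequentially \<times>\<^sub>F sequentially.
            norm (u k ^ (n + 2) * powr_second_diff s n) \<le> C * real n powr (-e)"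
    proof eventually_elim
      case (elim x)
      have "norm (u (snd x) ^ (fst x + 2) * powr_second_diff s (fst x)) \<le> 1 * (C * real (fst x) powr (-e))"
        unfolding norm_mult using d elim by (intro mult_mono norm_power_le_1 assms bd) auto
      thus ?case by (simp add: case_prod_unfold)
    qed
    show "summable (\<lambda>n. C * real n powr (-e))"
      using d by (intro summable_mult) (simp add: summable_real_powr_iff)
  qed auto
  thus ?thesis unfolding periodic_zeta_def using assms
    by (intro tendsto_intros) auto
qed

section \<open>Beta integrals over the half-line\<close>

abbreviation lborel_pos :: "real measure" where
  "lborel_pos \<equiv> restrict_space lborel {0<..}"

lemma nn_integral_Gamma_scaled:
  fixes a c :: real
  assumes "a > 0" "c > 0"
  shows "(\<integral>\<^sup>+t. ennreal (t powr (a - 1) * exp (-c * t)) \<partial>lborel_pos) = ennreal (Gamma a * c powr (-a))"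
proof -
  have "ennreal (Gamma a) = (\<integral>\<^sup>+t. ennreal (indicator {0..} t * t powr (a - 1) / exp t) \<partial>lborel)"
    using Gamma_conv_nn_integral_real[OF assms(1)] .
  also have "\<dots> = ennreal \<bar>c\<bar> * (\<integral>\<^sup>+t. ennreal (indicator {0..} (0 + c * t) * (0 + c * t) powr (a - 1) / exp (0 + c * t)) \<partial>lborel)"
    using assms by (subst nn_integral_real_affine[where c = c and t = 0]) auto
  also have "\<dots> = ennreal \<bar>c\<bar> * (\<integral>\<^sup>+t. ennreal (c powr (a - 1)) * (ennreal (t powr (a - 1) * exp (-c * t)) * indicator {0<..} t) \<partial>lborel)"
  proof (intro arg_cong2[where f = "(*)"] refl nn_integral_cong)
    fix t :: real
    have "t = 0 \<or> t < 0 \<or> t > 0" by linarith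
    moreover have "c * t < 0" if "t < 0" using that assms by (simp add: mult_pos_neg)
    ultimately show "ennreal (indicator {0..} (0 + c * t) * (0 + c * t) powr (a - 1) / exp (0 + c * t)) =
           ennreal (c powr (a - 1)) * (ennreal (t powr (a - 1) * exp (-c * t)) * indicator {0<..} t)"
      using assms by (auto simp: indicator_def powr_mult exp_minus field_simps simp flip: ennreal_mult)
  qed
  also have "\<dots> = ennreal \<bar>c\<bar> * (ennreal (c powr (a - 1)) * (\<integral>\<^sup>+t. ennreal (t powr (a - 1) * exp (-c * t)) * indicator {0<..} t \<partial>lborel))"
    by (subst nn_integral_cmult) auto
  also have "(\<integral>\<^sup>+t. ennreal (t powr (a - 1) * exp (-c * t)) * indicator {0<..} t \<partial>lborel)
      = (\<integral>\<^sup>+t. ennreal (t powr (a - 1) * exp (-c * t)) \<partial>lborel_pos)" (is "_ = ?I")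
    by (subst nn_integral_restrict_space) auto
  also have "ennreal \<bar>c\<bar> * (ennreal (c powr (a - 1)) * ?I) = ennreal (c powr a) * ?I"
    using assms by (simp add: powr_diff field_simps flip: ennreal_mult mult.assoc)
  finally have "ennreal (c powr (-a)) * ennreal (Gamma a) = ennreal (c powr (-a)) * ennreal (c powr a) * ?I"
    by (simp add: mult.assoc)
  also have "ennreal (c powr (-a)) * ennreal (c powr a) = 1"
    using assms by (simp add: powr_minus flip: ennreal_mult)
  finally show ?thesis using assms
    by (simp add: mult.commute flip: ennreal_mult)
qed

lemma sigma_finite_lborel_pos: "sigma_finite_measure lborel_pos"
  by (intro sigma_finite_measure_restrict_space) (auto simp: lborel.sigma_finite_measure_axioms)

text \<open>
  Write (1 + v)^(-2) as the Gamma integral of y e^(-(1 + v) y) and interchange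
  the two integrations; both are then Gamma integrals.
\<close>

lemma nn_integral_beta_prime:
  fixes p :: real
  assumes "p > 0" "p < 2"
  shows "(\<integral>\<^sup>+v. ennreal (v powr (p - 1) / (1 + v)\<^sup>2) \<partial>lborel_pos) = ennreal (Gamma p * Gamma (2 - p))"
proof -
  interpret pair_sigma_finite lborel_pos lborel_pos
    unfolding pair_sigma_finite_def using sigma_finite_lborel_pos by simp
  have "(\<integral>\<^sup>+v. ennreal (v powr (p - 1) / (1 + v)\<^sup>2) \<partial>lborel_pos) =
        (\<integral>\<^sup>+v. \<integral>\<^sup>+y. ennreal (v powr (p - 1) * (y * exp (-(1 + v) * y))) \<partial>lborel_pos \<partial>lborel_pos)"
  proof (intro nn_integral_cong)
    fix v :: real assume "v \<in> space lborel_pos"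
    hence v: "v > 0" by (simp add: space_restrict_space)
    have "(\<integral>\<^sup>+y. ennreal (v powr (p - 1) * (y * exp (-(1 + v) * y))) \<partial>lborel_pos)
        = (\<integral>\<^sup>+y. ennreal (v powr (p - 1)) * ennreal (y powr (2 - 1) * exp (-(1 + v) * y)) \<partial>lborel_pos)"
      by (intro nn_integral_cong) (auto simp: space_restrict_space simp flip: ennreal_mult)
    also have "\<dots> = ennreal (v powr (p - 1)) * (\<integral>\<^sup>+y. ennreal (y powr (2 - 1) * exp (-(1 + v) * y)) \<partial>lborel_pos)"
      by (intro nn_integral_cmult) (auto intro!: measurable_restrict_space1)
    also have "(\<integral>\<^sup>+y. ennreal (y powr (2 - 1) * exp (-(1 + v) * y)) \<partial>lborel_pos) = ennreal (Gamma 2 * (1 + v) powr (-2))"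
      using v by (intro nn_integral_Gamma_scaled) auto
    also have "ennreal (v powr (p - 1)) * \<dots> = ennreal (v powr (p - 1) / (1 + v)\<^sup>2)"
      using v Gamma_fact[of 1, where ?'a = real] by (simp add: powr_minus field_simps flip: ennreal_mult)
    finally show "ennreal (v powr (p - 1) / (1 + v)\<^sup>2) = (\<integral>\<^sup>+y. ennreal (v powr (p - 1) * (y * exp (-(1 + v) * y))) \<partial>lborel_pos)" ..
  qed
  also have "\<dots> = (\<integral>\<^sup>+y. \<integral>\<^sup>+v. ennreal (v powr (p - 1) * (y * exp (-(1 + v) * y))) \<partial>lborel_pos \<partial>lborel_pos)"
  proof -
    have id[measurable]: "(\<lambda>x. x) \<in> borel_measurable lborel_pos"
      by (intro measurable_restrict_space1) auto
    have "(\<lambda>(y, v). ennreal (v powr (p - 1) * (y * exp (-(1 + v) * y)))) \<in> borel_measurable (lborel_pos \<Otimes>\<^sub>M lborel_pos)"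
      by measurable
    from Fubini'[OF this] show ?thesis .
  qed
  also have "\<dots> = (\<integral>\<^sup>+y. ennreal (Gamma p) * ennreal (y powr ((2 - p) - 1) * exp (-1 * y)) \<partial>lborel_pos)"
  proof (intro nn_integral_cong)
    fix y :: real assume "y \<in> space lborel_pos"
    hence y: "y > 0" by (simp add: space_restrict_space)
    have "(\<integral>\<^sup>+v. ennreal (v powr (p - 1) * (y * exp (-(1 + v) * y))) \<partial>lborel_pos) =
          (\<integral>\<^sup>+v. ennreal (y * exp (-y)) * ennreal (v powr (p - 1) * exp (-y * v)) \<partial>lborel_pos)"
      using y by (intro nn_integral_cong) (auto simp: algebra_simps exp_diff exp_minus exp_add field_simps simp flip: ennreal_mult)
    also have "\<dots> = ennreal (y * exp (-y)) * (\<integral>\<^sup>+v. ennreal (v powr (p - 1) * exp (-y * v)) \<partial>lborel_pos)"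
      by (intro nn_integral_cmult) (auto intro!: measurable_restrict_space1)
    also have "(\<integral>\<^sup>+v. ennreal (v powr (p - 1) * exp (-y * v)) \<partial>lborel_pos) = ennreal (Gamma p * y powr (-p))"
      using y assms by (intro nn_integral_Gamma_scaled)
    also have "ennreal (y * exp (-y)) * \<dots> = ennreal (Gamma p) * ennreal (y powr ((2 - p) - 1) * exp (-1 * y))"
      using y assms by (simp add: powr_minus powr_diff power2_eq_square field_simps flip: ennreal_mult)
    finally show "(\<integral>\<^sup>+v. ennreal (v powr (p - 1) * (y * exp (-(1 + v) * y))) \<partial>lborel_pos) = \<dots>" .
  qed
  also have "\<dots> = ennreal (Gamma p) * (\<integral>\<^sup>+y. ennreal (y powr ((2 - p) - 1) * exp (-1 * y)) \<partial>lborel_pos)"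
    by (intro nn_integral_cmult) (auto intro!: measurable_restrict_space1)
  also have "\<dots> = ennreal (Gamma p) * ennreal (Gamma (2 - p) * 1 powr (-(2 - p)))"
    using assms by (subst nn_integral_Gamma_scaled) auto
  also have "\<dots> = ennreal (Gamma p * Gamma (2 - p))"
    using assms by (simp flip: ennreal_mult)
  finally show ?thesis .
qed


lemma integral_lborel_pos_scale:
  fixes f :: "real \<Rightarrow> 'a :: {banach, second_countable_topology}"
  assumes "c > 0"
  shows integrable_lborel_pos_scale: "integrable lborel_pos (\<lambda>t. f (c * t)) \<longleftrightarrow> integrable lborel_pos f"
    and "integral\<^sup>L lborel_pos f = c *\<^sub>R integral\<^sup>L lborel_pos (\<lambda>t. f (c * t))"
proof -
  have *: "(\<lambda>t. indicator {0<..} (0 + c * t) *\<^sub>R f (0 + c * t)) = (\<lambda>t. indicator {0<..} t *\<^sub>R f (c * t))"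
    using assms by (auto simp: fun_eq_iff indicator_def zero_less_mult_iff)
  show "integrable lborel_pos (\<lambda>t. f (c * t)) \<longleftrightarrow> integrable lborel_pos f"
    using lborel_integrable_real_affine_iff[of c "\<lambda>t. indicator {0<..} t *\<^sub>R f t" 0] assms
    unfolding * by (simp add: integrable_restrict_space)
  show "integral\<^sup>L lborel_pos f = c *\<^sub>R integral\<^sup>L lborel_pos (\<lambda>t. f (c * t))"
    using lborel_integral_real_affine[of c "\<lambda>t. indicator {0<..} t *\<^sub>R f t" 0] assms
    unfolding * by (simp add: integral_restrict_space)
qed

text \<open>
  Obtained from the preceding integral by the substitution v = t^2.
\<close>

lemma has_bochner_integral_beta_prime_square:
  fixes p :: real
  assumes "p > 0" "p < 2"
  shows "has_bochner_integral lborel_pos (\<lambda>t. t powr (2 * p - 1) / (1 + t\<^sup>2)\<^sup>2) (Gamma p * Gamma (2 - p) / 2)"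
proof -
  define h where "h = (\<lambda>v::real. v powr (p - 1) / (1 + v)\<^sup>2)"
  define f where "f = (\<lambda>t::real. t powr (2 * p - 1) / (1 + t\<^sup>2)\<^sup>2)"
  have "integrable lborel_pos h \<and> integral\<^sup>L lborel_pos h = Gamma p * Gamma (2 - p)"
  proof (subst nn_integral_eq_integrable [symmetric])
    show "h \<in> borel_measurable lborel_pos" unfolding h_def by (intro measurable_restrict_space1) measurable
    show "AE x in lborel_pos. 0 \<le> h x" by (auto simp: h_def)
    show "0 \<le> Gamma p * Gamma (2 - p)" using assms by (intro mult_nonneg_nonneg) (auto intro: Gamma_real_nonneg)
    show "(\<integral>\<^sup>+v. ennreal (h v) \<partial>lborel_pos) = ennreal (Gamma p * Gamma (2 - p))"
      unfolding h_def using assms by (rule nn_integral_beta_prime)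
  qed
  hence h: "integrable lborel_pos h" "integral\<^sup>L lborel_pos h = Gamma p * Gamma (2 - p)" by auto
  have eq: "f (sqrt v) * (1 / (2 * sqrt v)) = h v / 2" if "v > 0" for v
  proof -
    have "sqrt v powr (2 * p - 1) = sqrt v powr (2 * (p - 1)) * sqrt v"
      using that powr_add[of "sqrt v" "2 * (p - 1)" 1] by (simp add: algebra_simps)
    also have "sqrt v powr (2 * (p - 1)) = v powr (p - 1)"
      using that by (simp add: powr_half_sqrt [symmetric] powr_powr diff_divide_distrib)
    finally show ?thesis using that by (simp add: f_def h_def)
  qed
  have ei: "einterval 0 \<infinity> = {0<..}" by (auto simp: einterval_def zero_ereal_def)
  have int_h2: "set_integrable lborel (einterval 0 \<infinity>) (\<lambda>v. f (sqrt v) * (1 / (2 * sqrt v)))"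
  proof -
    have "set_integrable lborel {0<..} (\<lambda>v. h v / 2)"
      using h(1) by (auto simp: set_integrable_def integrable_restrict_space)
    also have "?this \<longleftrightarrow> ?thesis" unfolding ei
      by (intro set_integrable_cong refl) (simp only: greaterThan_iff eq)
    finally show ?thesis .
  qed
  have lim0: "((ereal \<circ> sqrt \<circ> real_of_ereal) \<longlongrightarrow> 0) (at_right 0)"
    unfolding zero_ereal_def ereal_tendsto_simps
    by (auto intro!: tendsto_eq_intros)
  have limi: "((ereal \<circ> sqrt \<circ> real_of_ereal) \<longlongrightarrow> \<infinity>) (at_left \<infinity>)"
    unfolding ereal_tendsto_simps
    by (simp add: sqrt_at_top)
  have sub: "set_integrable lborel (einterval 0 \<infinity>) f"
      "(LBINT x=0..\<infinity>. f x) = (LBINT x=0..\<infinity>. f (sqrt x) * (1 / (2 * sqrt x)))"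
  proof -
    have *: "x > 0 \<Longrightarrow> DERIV sqrt x :> 1 / (2 * sqrt x)" for x :: real
      by (auto intro!: derivative_eq_intros simp: field_simps)
    have cf: "x > 0 \<Longrightarrow> isCont f (sqrt x)" for x :: real
      unfolding f_def by (intro continuous_intros) (auto simp: add_nonneg_eq_0_iff)
    have cg: "x > 0 \<Longrightarrow> isCont (\<lambda>x. 1 / (2 * sqrt x)) x" for x :: real
      by (intro continuous_intros) auto
    show "set_integrable lborel (einterval 0 \<infinity>) f"
      "(LBINT x=0..\<infinity>. f x) = (LBINT x=0..\<infinity>. f (sqrt x) * (1 / (2 * sqrt x)))"
      using interval_integral_substitution_nonneg[of 0 \<infinity> sqrt "\<lambda>x. 1 / (2 * sqrt x)" f,
          OF _ * cf cg _ _ lim0 limi int_h2] by (auto simp: f_def)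
  qed
  have "integral\<^sup>L lborel_pos f = (LBINT x=0..\<infinity>. f x)"
    by (simp add: interval_lebesgue_integral_def ei set_lebesgue_integral_def integral_restrict_space)
  also have "\<dots> = integral\<^sup>L lborel_pos (\<lambda>v. f (sqrt v) * (1 / (2 * sqrt v)))"
    unfolding sub(2)
    by (simp add: interval_lebesgue_integral_def ei set_lebesgue_integral_def integral_restrict_space)
  also have "\<dots> = integral\<^sup>L lborel_pos (\<lambda>v. h v / 2)"
    by (rule Bochner_Integration.integral_cong) (use eq in \<open>auto simp: space_restrict_space\<close>)
  also have "\<dots> = Gamma p * Gamma (2 - p) / 2" using h by simp
  finally show ?thesis using sub(1)
    unfolding f_def [symmetric] has_bochner_integral_iff
    by (simp add: ei set_integrable_def integrable_restrict_space)
qed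

lemma Gamma_times_Gamma_2_minus:
  fixes p :: real
  assumes "0 < p" "p < 2" "p \<noteq> 1"
  shows "Gamma p * Gamma (2 - p) = (1 - p) * pi / sin (pi * p)"
proof -
  have nz: "1 - p \<notin> \<int>\<^sub>\<le>\<^sub>0"
  proof
    assume "1 - p \<in> \<int>\<^sub>\<le>\<^sub>0"
    then obtain n where "1 - p = - of_nat n" by (auto elim!: nonpos_Ints_cases')
    hence "p = 1 + of_nat n" by simp
    with assms show False by (cases n) auto
  qed
  have "Gamma (2 - p) = (1 - p) * Gamma (1 - p)"
    using Gamma_plus1[OF nz] by (simp add: algebra_simps)
  hence "Gamma p * Gamma (2 - p) = (1 - p) * (Gamma p * Gamma (1 - p))"
    by simp
  moreover have "complex_of_real (Gamma p * Gamma (1 - p)) = complex_of_real (pi / sin (pi * p))"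
    using Gamma_reflection_complex[of "of_real p"]
    by (simp flip: Gamma_complex_of_real sin_of_real)
  ultimately show ?thesis
    unfolding of_real_eq_iff by simp
qed

text \<open>
  This is \<Gamma>(1 + s) \<Gamma>(1 - s) (-i)^(s - 1), with the Gamma factors evaluated by the
  reflection formula.
\<close>

definition mellin_const :: "real \<Rightarrow> complex" where
  "mellin_const s = of_real (pi * s / sin (pi * s)) * \<i> * exp (-\<i> * of_real (pi * s / 2))"

text \<open>
  Rotating the path of integration is avoided by the identity
  1 / (t - i)^2 = (t + i)^2 / (1 + t^2)^2, whose expansion has three terms with
  real beta integrals.
\<close>

lemma has_bochner_integral_mellin:
  fixes s :: real
  assumes s: "-1 < s" "s < 0"
  shows "has_bochner_integral lborel_pos (\<lambda>t. of_real (t powr s) / (of_real t - \<i>)\<^sup>2) (mellin_const s)"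
proof -
  define M where "M = (\<lambda>p. Gamma p * Gamma (2 - p) / 2 :: real)"
  define g where "g = (\<lambda>p t. t powr (2 * p - 1) / (1 + t\<^sup>2)\<^sup>2 :: real)"
  have hb: "has_bochner_integral lborel_pos (g p) (M p)" if "p > 0" "p < 2" for p
    using has_bochner_integral_beta_prime_square[OF that] by (simp add: g_def M_def)
  have pos: "sin (pi * s / 2) < 0" "cos (pi * s / 2) > 0"
  proof -
    have b: "pi * s < 0" "pi * s > -pi"
      using s mult_strict_left_mono[of "-1" s pi] by (auto simp: mult_pos_neg)
    have "sin (pi * (-s) / 2) > 0" using b by (intro sin_gt_zero) auto
    thus "sin (pi * s / 2) < 0" by simp
    show "cos (pi * s / 2) > 0" using b s by (intro cos_gt_zero_pi) auto
  qed
  have 1: "M ((s + 3) / 2) = (1 + s) / 4 * pi / cos (pi * s / 2)"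
  proof -
    have "sin (pi * ((s + 3) / 2)) = -cos (pi * s / 2)"
    proof -
      have "pi * ((s + 3) / 2) = pi * s / 2 + 3 / 2 * pi" by (simp add: field_simps)
      thus ?thesis by (simp only: sin_add sin_3over2_pi cos_3over2_pi)
    qed
    moreover have "M ((s + 3) / 2) = (1 - (s + 3) / 2) * pi / sin (pi * ((s + 3) / 2)) / 2"
      unfolding M_def using Gamma_times_Gamma_2_minus[of "(s + 3) / 2"] s by simp
    ultimately show ?thesis using pos by (simp add: divide_simps) (simp add: algebra_simps)?
  qed
  have 2: "M ((s + 1) / 2) = (1 - s) / 4 * pi / cos (pi * s / 2)"
  proof -
    have "sin (pi * ((s + 1) / 2)) = cos (pi * s / 2)"
      using sin_add[of "pi * s / 2" "pi / 2"] by (simp add: field_simps)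
    moreover have "M ((s + 1) / 2) = (1 - (s + 1) / 2) * pi / sin (pi * ((s + 1) / 2)) / 2"
      unfolding M_def using Gamma_times_Gamma_2_minus[of "(s + 1) / 2"] s by simp
    ultimately show ?thesis using pos by (simp add: divide_simps) (simp add: algebra_simps)?
  qed
  have 3: "M ((s + 2) / 2) = s / 4 * pi / sin (pi * s / 2)"
  proof -
    have "sin (pi * ((s + 2) / 2)) = -sin (pi * s / 2)"
      using sin_add[of "pi * s / 2" pi] by (simp add: field_simps)
    moreover have "M ((s + 2) / 2) = (1 - (s + 2) / 2) * pi / sin (pi * ((s + 2) / 2)) / 2"
      unfolding M_def using Gamma_times_Gamma_2_minus[of "(s + 2) / 2"] s by simp
    ultimately show ?thesis using pos by (simp add: divide_simps) (simp add: algebra_simps)?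
  qed
  \<comment> \<open>The three terms of (t + i)^2 = t^2 - 1 + 2 i t.\<close>
  have "has_bochner_integral lborel_pos
          (\<lambda>t. of_real (g ((s + 3) / 2) t) - of_real (g ((s + 1) / 2) t) + 2 * \<i> * of_real (g ((s + 2) / 2) t))
          (of_real (M ((s + 3) / 2)) - of_real (M ((s + 1) / 2)) + 2 * \<i> * of_real (M ((s + 2) / 2)))"
    using s by (intro has_bochner_integral_add has_bochner_integral_diff has_bochner_integral_mult_right 
                  has_bochner_integral_of_real hb) auto
  also have "?this \<longleftrightarrow> has_bochner_integral lborel_pos (\<lambda>t. of_real (t powr s) / (of_real t - \<i>)\<^sup>2)
          (of_real (M ((s + 3) / 2)) - of_real (M ((s + 1) / 2)) + 2 * \<i> * of_real (M ((s + 2) / 2)))"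
  proof (intro has_bochner_integral_cong refl)
    fix t assume "t \<in> space lborel_pos"
    hence t: "t > 0" by (simp add: space_restrict_space)
    have e: "t powr (2 * ((s + 3) / 2) - 1) = t powr s * t\<^sup>2" "t powr (2 * ((s + 1) / 2) - 1) = t powr s"
      "t powr (2 * ((s + 2) / 2) - 1) = t powr s * t"
    proof -
      have q: "2 * ((s + 3) / 2) - 1 = s + 2" "2 * ((s + 1) / 2) - 1 = s" "2 * ((s + 2) / 2) - 1 = s + 1"
        by (simp_all add: add_divide_distrib)
      show "t powr (2 * ((s + 3) / 2) - 1) = t powr s * t\<^sup>2" "t powr (2 * ((s + 1) / 2) - 1) = t powr s"
        "t powr (2 * ((s + 2) / 2) - 1) = t powr s * t"
        unfolding q using t powr_add[of t s 2] powr_add[of t s 1] by simp_all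
    qed
    have c: "(of_real t - \<i>) * (of_real t + \<i>) = of_real (1 + t\<^sup>2)"
      by (simp add: algebra_simps power2_eq_square)
    have "of_real (1 + t\<^sup>2) \<noteq> (0 :: complex)"
      by (metis of_real_eq_0_iff add_pos_nonneg less_irrefl zero_le_power2 zero_less_one)
    with c have nz: "of_real t - \<i> \<noteq> 0" "of_real t + \<i> \<noteq> 0" by auto
    have "of_real (g ((s + 3) / 2) t) - of_real (g ((s + 1) / 2) t) + 2 * \<i> * of_real (g ((s + 2) / 2) t)
       = of_real (t powr s) * (of_real t + \<i>)\<^sup>2 / (of_real (1 + t\<^sup>2))\<^sup>2"
      unfolding g_def e by (simp add: diff_divide_distrib add_divide_distrib algebra_simps power2_eq_square)
    also have "\<dots> = of_real (t powr s) / (of_real t - \<i>)\<^sup>2"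
      unfolding c [symmetric] using nz by (simp add: power_mult_distrib)
    finally show "of_real (g ((s + 3) / 2) t) - of_real (g ((s + 1) / 2) t) + 2 * \<i> * of_real (g ((s + 2) / 2) t)
       = of_real (t powr s) / (of_real t - \<i>)\<^sup>2" .
  qed
  also have "of_real (M ((s + 3) / 2)) - of_real (M ((s + 1) / 2)) + 2 * \<i> * of_real (M ((s + 2) / 2)) = mellin_const s"
  proof -
    define S where "S = sin (pi * s / 2)"
    define K where "K = cos (pi * s / 2)"
    have nz: "S \<noteq> 0" "K \<noteq> 0" using pos by (auto simp: S_def K_def)
    have "exp (-\<i> * of_real (pi * s / 2)) = cis (-(pi * s / 2))" by (simp add: cis_conv_exp)
    also have "\<dots> = of_real K - \<i> * of_real S" by (simp add: complex_eq_iff K_def S_def)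
    finally have m: "mellin_const s = of_real (pi * s / (2 * S * K)) * \<i> * (of_real K - \<i> * of_real S)"
      using sin_double[of "pi * s / 2"] by (simp add: mellin_const_def S_def K_def)
    show ?thesis unfolding m 1 2 3 S_def [symmetric] K_def [symmetric] using nz
      by (simp add: complex_eq_iff field_simps)
  qed
  finally show ?thesis .
qed

section \<open>Partial fractions of the kernel\<close>

lemma sin_of_real_pi_times_nonzero:
  fixes z :: complex
  assumes "z \<notin> \<int>"
  shows   "sin (of_real pi * z) \<noteq> 0"
proof
  assume "sin (of_real pi * z) = 0"
  then obtain n :: int where "of_real pi * z = of_real (real_of_int n * pi)"
    unfolding sin_eq_0 by blast
  hence "z = of_int n" by simp
  with assms show False by simp
qed

text \<open>
  The logarithmic derivative of the reflection formula for \<Gamma>.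
\<close>

lemma Digamma_reflection:
  fixes z :: complex
  assumes "z \<notin> \<int>"
  shows   "Digamma z - Digamma (1 - z) = -of_real pi * cos (of_real pi * z) / sin (of_real pi * z)"
proof -
  have 1: "1 - z \<notin> \<int>" using assms by (metis Ints_1 Ints_diff diff_diff_eq2 add_diff_cancel_left')
  have nz: "sin (of_real pi * z) \<noteq> 0" using assms by (rule sin_of_real_pi_times_nonzero)
  have ni: "z \<notin> \<int>\<^sub>\<le>\<^sub>0" "1 - z \<notin> \<int>\<^sub>\<le>\<^sub>0" using assms 1 nonpos_Ints_subset_Ints by blast+
  have "((\<lambda>z. Gamma z * Gamma (1 - z)) has_field_derivative
          Gamma z * Digamma z * Gamma (1 - z) - Gamma z * (Gamma (1 - z) * Digamma (1 - z))) (at z)"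
    using ni by (auto intro!: derivative_eq_intros)
  moreover have "((\<lambda>z. Gamma z * Gamma (1 - z)) has_field_derivative
          -of_real pi * (of_real pi * cos (of_real pi * z)) / (sin (of_real pi * z))\<^sup>2) (at z)"
    unfolding Gamma_reflection_complex using nz
    by (auto intro!: derivative_eq_intros simp: power2_eq_square)
  ultimately have "Gamma z * Digamma z * Gamma (1 - z) - Gamma z * (Gamma (1 - z) * Digamma (1 - z)) = 
          -of_real pi * (of_real pi * cos (of_real pi * z)) / (sin (of_real pi * z))\<^sup>2"
    by (rule DERIV_unique)
  hence "(Gamma z * Gamma (1 - z)) * (Digamma z - Digamma (1 - z)) = 
          -of_real pi * (of_real pi * cos (of_real pi * z)) / (sin (of_real pi * z))\<^sup>2"
    by (simp add: algebra_simps)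
  hence "of_real pi / sin (of_real pi * z) * (Digamma z - Digamma (1 - z)) =
           of_real pi / sin (of_real pi * z) * (-of_real pi * cos (of_real pi * z) / sin (of_real pi * z))"
    unfolding Gamma_reflection_complex by (simp add: power2_eq_square)
  thus ?thesis using nz by (subst (asm) mult_cancel_left) auto
qed

lemma Polygamma_1_reflection:
  fixes z :: complex
  assumes "z \<notin> \<int>"
  shows   "Polygamma 1 z + Polygamma 1 (1 - z) = (of_real pi / sin (of_real pi * z))\<^sup>2"
proof -
  have 1: "1 - z \<notin> \<int>" using assms by (metis Ints_1 Ints_diff diff_diff_eq2 add_diff_cancel_left')
  have nz: "sin (of_real pi * z) \<noteq> 0" using assms by (rule sin_of_real_pi_times_nonzero)
  have ni: "z \<notin> \<int>\<^sub>\<le>\<^sub>0" "1 - z \<notin> \<int>\<^sub>\<le>\<^sub>0" using assms 1 nonpos_Ints_subset_Ints by blast+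
  have "((\<lambda>z. Digamma z - Digamma (1 - z)) has_field_derivative (Polygamma 1 z + Polygamma 1 (1 - z))) (at z)"
    using ni by (auto intro!: derivative_eq_intros)
  moreover have "((\<lambda>z. Digamma z - Digamma (1 - z)) has_field_derivative (of_real pi / sin (of_real pi * z))\<^sup>2) (at z)"
  proof (rule has_field_derivative_transform_within_open)
    define S where "S = sin (of_real pi * z)"
    define C where "C = cos (of_real pi * z)"
    have SC: "S\<^sup>2 + C\<^sup>2 = 1" by (simp add: S_def C_def)
    have "((\<lambda>z. -of_real pi * cos (of_real pi * z) / sin (of_real pi * z)) has_field_derivative
         - ((- (S * of_real pi * of_real pi * S) - of_real pi * C * (C * of_real pi)) / (S * S))) (at z)"
      using nz unfolding S_def C_def
      by (auto intro!: derivative_eq_intros)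
    also have "- ((- (S * of_real pi * of_real pi * S) - of_real pi * C * (C * of_real pi)) / (S * S)) =
                 (of_real pi)\<^sup>2 * (S\<^sup>2 + C\<^sup>2) / S\<^sup>2"
      unfolding minus_divide_left by (simp add: algebra_simps power2_eq_square)
    also have "\<dots> = (of_real pi / S)\<^sup>2" unfolding SC by (simp add: power_divide)
    finally show "((\<lambda>z. -of_real pi * cos (of_real pi * z) / sin (of_real pi * z)) has_field_derivative
         (of_real pi / sin (of_real pi * z))\<^sup>2) (at z)" by (simp add: S_def)
    show "open (- \<int> :: complex set)" by (simp add: open_Compl)
  qed (use assms Digamma_reflection in auto)
  ultimately show ?thesis by (rule DERIV_unique)
qed

text \<open>
  With a = x + i t / (2 pi) one has u = exp(2 pi i a), hence
  u / (1 - u)^2 = -1 / (4 sin^2(pi a)), and the reflection formula turns this into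
  trigamma values at a and 1 - a, which are sums of inverse squares.  The summands coming from 1 - a are
  complex conjugates of those that a would give with 1 - x in place of x.
\<close>

lemma kernel_partial_fractions:
  fixes x t :: real
  assumes x: "0 < x" "x < 1"
  defines "u \<equiv> cis (2 * pi * x) * of_real (exp (-t))"
  shows "(\<lambda>k. 1 / (of_real t - \<i> * of_real (2 * pi * (x + real k)))\<^sup>2 +
              cnj (1 / (of_real t - \<i> * of_real (2 * pi * (1 - x + real k)))\<^sup>2)) sums (u / (1 - u)\<^sup>2)"
proof -
  define a where "a = of_real x + \<i> * of_real t / of_real (2 * pi)"
  have a: "a \<notin> \<int>"
  proof
    assume "a \<in> \<int>"
    then obtain n where "a = of_int n" by (auto elim: Ints_cases)
    hence "Re a = of_int n" by simp
    hence "x = of_int n" by (simp add: a_def)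
    with x show False by auto
  qed
  hence a0: "a \<noteq> 0" "1 - a \<noteq> 0" by auto
  define E where "E = exp (\<i> * (of_real pi * a))"
  have E0: "E \<noteq> 0" by (simp add: E_def)
  have u: "u = E\<^sup>2"
  proof -
    have "E\<^sup>2 = exp (2 * (\<i> * (of_real pi * a)))" by (simp add: E_def exp_double)
    also have "2 * (\<i> * (of_real pi * a)) = \<i> * of_real (2 * pi * x) + of_real (-t)"
      by (simp add: a_def field_simps)
    also have "exp \<dots> = u" by (simp only: exp_add u_def cis_conv_exp exp_of_real)
    finally show ?thesis ..
  qed
  have sinE: "sin (of_real pi * a) = (E - 1 / E) / (2 * \<i>)"
    by (simp add: sin_exp_eq E_def exp_minus divide_simps)
  have snz: "sin (of_real pi * a) \<noteq> 0" using a by (rule sin_of_real_pi_times_nonzero)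
  have E1: "E\<^sup>2 \<noteq> 1"
  proof
    assume "E\<^sup>2 = 1"
    hence "1 / E = E" using E0 by (simp add: power2_eq_square field_simps)
    thus False using snz unfolding sinE by simp
  qed
  have "(\<lambda>k. -1 / (4 * of_real pi ^ 2) * (inverse ((a + of_nat k) ^ Suc 1) + inverse (((1 - a) + of_nat k) ^ Suc 1)))
          sums (-1 / (4 * of_real pi ^ 2) * ((-1) ^ Suc 1 * Polygamma 1 a / fact 1 + (-1) ^ Suc 1 * Polygamma 1 (1 - a) / fact 1))"
    by (intro sums_mult sums_add Polygamma_LIMSEQ a0) auto
  also have "-1 / (4 * of_real pi ^ 2) * ((-1) ^ Suc 1 * Polygamma 1 a / fact 1 + (-1) ^ Suc 1 * Polygamma 1 (1 - a) / fact 1)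
     = -1 / (4 * of_real pi ^ 2) * (Polygamma 1 a + Polygamma 1 (1 - a))" by simp
  also have "\<dots> = -1 / (4 * (sin (of_real pi * a))\<^sup>2)"
    unfolding Polygamma_1_reflection[OF a] by (simp add: power_divide)
  also have "\<dots> = u / (1 - u)\<^sup>2"
    unfolding sinE u using E0 E1
    by (simp add: divide_simps power2_eq_square) (simp add: algebra_simps)
  also have "(\<lambda>k. -1 / (4 * of_real pi ^ 2) * (inverse ((a + of_nat k) ^ Suc 1) + inverse (((1 - a) + of_nat k) ^ Suc 1))) =
     (\<lambda>k. 1 / (of_real t - \<i> * of_real (2 * pi * (x + real k)))\<^sup>2 +
              cnj (1 / (of_real t - \<i> * of_real (2 * pi * (1 - x + real k)))\<^sup>2))"
  proof
    fix k :: nat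
    define c where "c = \<i> / (2 * of_real pi)"
    define W where "W = of_real t - \<i> * of_real (2 * pi * (x + real k))"
    define V where "V = of_real t - \<i> * of_real (2 * pi * (1 - x + real k))"
    have e1: "a + of_nat k = c * W"
      by (simp add: a_def c_def W_def complex_eq_iff field_simps)
    have e2: "1 - a + of_nat k = -c * cnj V"
      by (simp add: a_def c_def V_def complex_eq_iff field_simps)
    have c: "-1 / (4 * of_real pi ^ 2) = c\<^sup>2" "c \<noteq> 0"
      by (auto simp: c_def power_divide power_mult_distrib)
    have "c\<^sup>2 * (inverse ((c * W) ^ Suc 1) + inverse ((-c * cnj V) ^ Suc 1)) = 1 / W\<^sup>2 + cnj (1 / V\<^sup>2)"
      using c(2) by (simp add: distrib_left inverse_eq_divide power2_eq_square)
    thus "-1 / (4 * of_real pi ^ 2) * (inverse ((a + of_nat k) ^ Suc 1) + inverse (((1 - a) + of_nat k) ^ Suc 1)) =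
          1 / (of_real t - \<i> * of_real (2 * pi * (x + real k)))\<^sup>2 +
              cnj (1 / (of_real t - \<i> * of_real (2 * pi * (1 - x + real k)))\<^sup>2)"
      unfolding e1 e2 c(1) W_def V_def .
  qed
  finally show ?thesis .
qed

lemma summable_shifted_powr:
  fixes x e :: real
  assumes "x > 0" "e > 1"
  shows "summable (\<lambda>k. (x + real k) powr (-e))"
proof (rule summable_comparison_test_ev)
  show "summable (\<lambda>k. real k powr (-e))" using assms by (simp add: summable_real_powr_iff)
  show "\<forall>\<^sub>F k in sequentially. norm ((x + real k) powr (-e)) \<le> real k powr (-e)"
    using eventually_gt_at_top[of 0] by eventually_elim (use assms in \<open>auto intro!: powr_mono2'\<close>)
qed

text \<open>
  Scaling t by b = 2 pi (x + k) reduces every summand to the case of has_bochner_integral_mellin and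
  contributes a factor b^(s - 1).  The condition s < 0 makes the sum over k converge
  absolutely, so that it may be interchanged with the integral.
\<close>

lemma has_bochner_integral_progression:
  fixes x s :: real
  assumes x: "x > 0" and s: "-1 < s" "s < 0"
  shows "has_bochner_integral lborel_pos
           (\<lambda>t. \<Sum>k. of_real (t powr s) * (1 / (of_real t - \<i> * of_real (2 * pi * (x + real k)))\<^sup>2))
           (mellin_const s * of_real ((2 * pi) powr (s - 1) * (\<Sum>k. (x + real k) powr (s - 1))))"
    and "t > 0 \<Longrightarrow> summable (\<lambda>k. norm (of_real (t powr s) * (1 / (of_real t - \<i> * of_real (2 * pi * (x + real k)))\<^sup>2)))"
proof -
  define b where "b = (\<lambda>k. 2 * pi * (x + real k))"
  define h where "h = (\<lambda>t. of_real (t powr s) / (of_real t - \<i>)\<^sup>2)"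
  define f where "f = (\<lambda>k t. of_real (t powr s) * (1 / (of_real t - \<i> * of_real (b k))\<^sup>2))"
  define K where "K = (LINT t|lborel_pos. norm (h t))"
  have b: "b k > 0" for k using x by (auto simp: b_def intro!: mult_pos_pos add_pos_nonneg)
  have h: "integrable lborel_pos h" "integral\<^sup>L lborel_pos h = mellin_const s"
    using has_bochner_integral_mellin[OF s] unfolding h_def by (auto simp: has_bochner_integral_iff)
  have scale: "f k (b k * t) = of_real (b k powr (s - 2)) * h t" if "t > 0" for k t
  proof -
    have "f k (b k * t) = of_real (b k powr s * t powr s) * (1 / (of_real (b k) * (of_real t - \<i>))\<^sup>2)"
      using that b[of k] by (simp add: f_def powr_mult algebra_simps)
    also have "\<dots> = of_real (b k powr s / (b k)\<^sup>2) * h t"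
      by (simp add: h_def power_mult_distrib)
    also have "b k powr s / (b k)\<^sup>2 = b k powr (s - 2)"
      using b[of k] by (simp add: powr_diff)
    finally show ?thesis .
  qed
  have bs: "b k * b k powr (s - 2) = b k powr (s - 1)" for k
    using b[of k] powr_add[of "b k" 1 "s - 2"] by simp
  have int_f: "integrable lborel_pos (f k)" for k
  proof -
    have "integrable lborel_pos (\<lambda>t. f k (b k * t)) \<longleftrightarrow> integrable lborel_pos (\<lambda>t. of_real (b k powr (s - 2)) * h t)"
      by (rule Bochner_Integration.integrable_cong) (auto simp: space_restrict_space scale)
    with h show ?thesis using integrable_lborel_pos_scale[OF b[of k], of "f k"] by auto
  qed
  have val_f: "integral\<^sup>L lborel_pos (f k) = of_real (b k powr (s - 1)) * mellin_const s" for k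
  proof -
    have "integral\<^sup>L lborel_pos (f k) = b k *\<^sub>R (LINT t|lborel_pos. f k (b k * t))"
      by (rule integral_lborel_pos_scale(2)[OF b])
    also have "(LINT t|lborel_pos. f k (b k * t)) = (LINT t|lborel_pos. of_real (b k powr (s - 2)) * h t)"
      by (rule Bochner_Integration.integral_cong) (auto simp: space_restrict_space scale)
    also have "\<dots> = of_real (b k powr (s - 2)) * mellin_const s" using h by simp
    also have "b k *\<^sub>R (of_real (b k powr (s - 2)) * mellin_const s) = of_real (b k powr (s - 1)) * mellin_const s"
      unfolding bs [of k, symmetric] by (simp add: scaleR_conv_of_real)
    finally show ?thesis .
  qed
  have val_norm: "(LINT t|lborel_pos. norm (f k t)) = b k powr (s - 1) * K" for k
  proof -
    have "(LINT t|lborel_pos. norm (f k t)) = b k *\<^sub>R (LINT t|lborel_pos. norm (f k (b k * t)))"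
      by (rule integral_lborel_pos_scale(2)[OF b])
    also have "(LINT t|lborel_pos. norm (f k (b k * t))) = (LINT t|lborel_pos. b k powr (s - 2) * norm (h t))"
      by (rule Bochner_Integration.integral_cong) (auto simp: space_restrict_space scale norm_mult)
    also have "\<dots> = b k powr (s - 2) * K" by (simp add: K_def)
    also have "b k *\<^sub>R (b k powr (s - 2) * K) = b k powr (s - 1) * K"
      unfolding bs [of k, symmetric] by simp
    finally show ?thesis .
  qed
  have bsum: "summable (\<lambda>k. b k powr (-e))" and bsuminf: "(\<Sum>k. b k powr (-e)) = (2 * pi) powr (-e) * (\<Sum>k. (x + real k) powr (-e))"
    if "e > 1" for e
  proof -
    have *: "(\<lambda>k. b k powr (-e)) = (\<lambda>k. (2 * pi) powr (-e) * (x + real k) powr (-e))"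
      using x by (simp add: b_def powr_mult)
    show "summable (\<lambda>k. b k powr (-e))" unfolding * using that x by (intro summable_mult summable_shifted_powr)
    show "(\<Sum>k. b k powr (-e)) = (2 * pi) powr (-e) * (\<Sum>k. (x + real k) powr (-e))"
      unfolding * using that x by (intro suminf_mult summable_shifted_powr)
  qed
  have sum_ptw: "summable (\<lambda>k. norm (f k t))" if "t > 0" for t
  proof (rule summable_comparison_test')
    show "summable (\<lambda>k. t powr s * b k powr (-2))" by (intro summable_mult bsum) auto
    fix k :: nat
    have "b k \<le> norm (of_real t - \<i> * of_real (b k))"
      using abs_Im_le_cmod[of "of_real t - \<i> * of_real (b k)"] b[of k] by simp
    hence "(b k)\<^sup>2 \<le> (norm (of_real t - \<i> * of_real (b k)))\<^sup>2"
      using b[of k] by (intro power_mono) auto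
    hence "1 / (norm (of_real t - \<i> * of_real (b k)))\<^sup>2 \<le> 1 / (b k)\<^sup>2"
      using b[of k] by (intro divide_left_mono) (auto intro!: mult_pos_pos simp: complex_eq_iff)
    hence "t powr s * (1 / (norm (of_real t - \<i> * of_real (b k)))\<^sup>2) \<le> t powr s * (1 / (b k)\<^sup>2)"
      by (intro mult_left_mono) auto
    thus "norm (norm (f k t)) \<le> t powr s * b k powr (-2)"
      using b[of k] by (simp add: f_def norm_mult norm_divide norm_power powr_minus field_simps)
  qed
  have sum_int: "summable (\<lambda>k. LINT t|lborel_pos. norm (f k t))"
    unfolding val_norm using bsum[of "1 - s"] s by (intro summable_mult2) auto
  have AE: "AE t in lborel_pos. summable (\<lambda>k. norm (f k t))"
    by (intro AE_I2 sum_ptw) (auto simp: space_restrict_space)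
  have "integrable lborel_pos (\<lambda>t. \<Sum>k. f k t)"
    by (rule integrable_suminf[OF int_f AE sum_int])
  moreover have "(LINT t|lborel_pos. (\<Sum>k. f k t)) = (\<Sum>k. of_real (b k powr (s - 1)) * mellin_const s)"
    unfolding val_f [symmetric] by (rule integral_suminf[OF int_f AE sum_int])
  moreover have "(\<Sum>k. of_real (b k powr (s - 1)) * mellin_const s) = 
      of_real (\<Sum>k. b k powr (s - 1)) * mellin_const s"
    using bsum[of "1 - s"] s by (subst suminf_mult2 [symmetric]) (auto simp: suminf_of_real)
  ultimately show "has_bochner_integral lborel_pos
           (\<lambda>t. \<Sum>k. of_real (t powr s) * (1 / (of_real t - \<i> * of_real (2 * pi * (x + real k)))\<^sup>2))
           (mellin_const s * of_real ((2 * pi) powr (s - 1) * (\<Sum>k. (x + real k) powr (s - 1))))"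
    using bsuminf[of "1 - s"] s unfolding has_bochner_integral_iff f_def b_def by (simp add: mult_ac)
  show "t > 0 \<Longrightarrow> summable (\<lambda>k. norm (of_real (t powr s) * (1 / (of_real t - \<i> * of_real (2 * pi * (x + real k)))\<^sup>2)))"
    using sum_ptw[of t] unfolding f_def b_def .
qed

section \<open>The Mellin transform of the kernel\<close>

lemma has_bochner_integral_Gamma_scaled:
  fixes a c :: real
  assumes "a > 0" "c > 0"
  shows "has_bochner_integral lborel_pos (\<lambda>t. t powr (a - 1) * exp (-c * t)) (Gamma a * c powr (-a))"
proof -
  have "integrable lborel_pos (\<lambda>t. t powr (a - 1) * exp (-c * t)) \<and>
          integral\<^sup>L lborel_pos (\<lambda>t. t powr (a - 1) * exp (-c * t)) = Gamma a * c powr (-a)"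
  proof (subst nn_integral_eq_integrable [symmetric])
    show "(\<lambda>t. t powr (a - 1) * exp (-c * t)) \<in> borel_measurable lborel_pos"
      by (intro measurable_restrict_space1) measurable
    show "0 \<le> Gamma a * c powr (-a)" using assms by (intro mult_nonneg_nonneg Gamma_real_nonneg) auto
  qed (use nn_integral_Gamma_scaled[OF assms] in auto)
  thus ?thesis by (simp add: has_bochner_integral_iff)
qed

text \<open>
  Expand the kernel as the sum of n u^n.  The integral of t^s n e^(-n t) is
  \<Gamma>(1 + s) n^(-s), which gains a factor n compared with the usual Mellin representation and
  therefore allows s > -1.
\<close>

lemma has_bochner_integral_periodic_zeta_in_disc:
  fixes s :: real
  assumes w: "norm w < 1" and s: "s > -1"
  shows "has_bochner_integral lborel_pos
           (\<lambda>t. of_real (t powr s) * (w * of_real (exp (-t)) / (1 - w * of_real (exp (-t)))\<^sup>2))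
           (of_real (Gamma (1 + s)) * periodic_zeta w (of_real s))"
proof -
  define g where "g = (\<lambda>(n::nat) t. t powr (s + 1 - 1) * exp (- real (Suc n) * t))"
  define f where "f = (\<lambda>n t. w ^ Suc n * of_nat (Suc n) * of_real (g n t))"
  define G where "G = (\<lambda>n. real (Suc n) powr (-s) * Gamma (1 + s))"
  have g: "integrable lborel_pos (g n)" "integral\<^sup>L lborel_pos (g n) = Gamma (s + 1) * real (Suc n) powr (-(s + 1))" for n
    using has_bochner_integral_Gamma_scaled[of "s + 1" "real (Suc n)"] s
    unfolding g_def has_bochner_integral_iff by auto
  have val_g: "real (Suc n) * integral\<^sup>L lborel_pos (g n) = G n" for n
  proof -
    have "real (Suc n) powr (-s) = real (Suc n) powr (-(s + 1) + 1)" by simp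
    also have "\<dots> = real (Suc n) powr (-(s + 1)) * real (Suc n) powr 1" by (rule powr_add)
    finally have "real (Suc n) powr (-s) = real (Suc n) powr (-(s + 1)) * real (Suc n)" by simp
    thus ?thesis unfolding g G_def by (simp only: add.commute[of 1 s]) (simp only: mult_ac)
  qed
  have int_f: "integrable lborel_pos (f n)" for n
    unfolding f_def using g(1)[of n] by (intro integrable_mult_right integrable_of_real)
  have val_f: "integral\<^sup>L lborel_pos (f n) = w ^ Suc n * of_real (G n)" for n
    unfolding f_def val_g[symmetric] using g(1)[of n] by simp
  have val_norm: "(LINT t|lborel_pos. norm (f n t)) = norm w ^ Suc n * G n" for n
  proof -
    have "(LINT t|lborel_pos. norm (f n t)) = (LINT t|lborel_pos. norm w ^ Suc n * real (Suc n) * g n t)"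
      by (rule Bochner_Integration.integral_cong)
         (auto simp: f_def g_def norm_mult norm_power simp del: of_nat_Suc)
    also have "\<dots> = norm w ^ Suc n * (real (Suc n) * integral\<^sup>L lborel_pos (g n))"
      by (simp add: mult.assoc del: of_nat_Suc)
    finally show ?thesis unfolding val_g .
  qed
  have pz: "(\<lambda>n. v ^ Suc n * of_real (G n)) sums (of_real (Gamma (1 + s)) * periodic_zeta v (of_real s))"
    if "norm v < 1" for v
  proof -
    have "(\<lambda>n. v ^ n * of_nat n powr (-of_real s)) sums periodic_zeta v (of_real s)"
      using that s by (intro periodic_zeta_sums_in_disc) auto
    hence "(\<lambda>n. v ^ Suc n * of_nat (Suc n) powr (-of_real s)) sums periodic_zeta v (of_real s)"
      by (subst sums_Suc_iff) simp
    hence "(\<lambda>n. of_real (Gamma (1 + s)) * (v ^ Suc n * of_nat (Suc n) powr (-of_real s))) sums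
             (of_real (Gamma (1 + s)) * periodic_zeta v (of_real s))"
      by (rule sums_mult)
    also have "(\<lambda>n. of_real (Gamma (1 + s)) * (v ^ Suc n * of_nat (Suc n) powr (-of_real s))) = 
               (\<lambda>n. v ^ Suc n * of_real (G n))"
    proof
      fix n
      have "of_nat (Suc n) powr (-of_real s) = complex_of_real (real (Suc n) powr (-s))"
        using powr_of_real[of "real (Suc n)" "-s"] by simp
      thus "of_real (Gamma (1 + s)) * (v ^ Suc n * of_nat (Suc n) powr (-of_real s)) = v ^ Suc n * of_real (G n)"
        by (simp add: G_def)
    qed
    finally show ?thesis .
  qed
  have sum_int: "summable (\<lambda>n. LINT t|lborel_pos. norm (f n t))"
  proof -
    have "summable (\<lambda>n. Re (of_real (norm w) ^ Suc n * of_real (G n)))"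
      using pz[of "of_real (norm w)"] w by (intro summable_Re sums_summable) auto
    also have "(\<lambda>n. Re (of_real (norm w) ^ Suc n * of_real (G n))) = (\<lambda>n. norm w ^ Suc n * G n)"
      by (simp flip: of_real_power)
    finally show ?thesis unfolding val_norm .
  qed
  have f_eq: "f n t = of_real (t powr s) * (w * of_real (exp (-t)) * (of_nat (Suc n) * (w * of_real (exp (-t))) ^ n))" for n t
  proof -
    have "exp (- real (Suc n) * t) = exp (-t) ^ Suc n"
      using exp_of_nat_mult[of "Suc n" "-t"] by (simp only: mult_minus_left mult_minus_right)
    thus ?thesis by (simp add: f_def g_def power_mult_distrib)
  qed
  have lt: "norm (w * of_real (exp (-t))) < 1" if "t > 0" for t
  proof -
    have "norm w * exp (-t) \<le> norm w * 1" using that by (intro mult_left_mono) auto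
    thus ?thesis using w by (simp add: norm_mult)
  qed
  have AE: "AE t in lborel_pos. summable (\<lambda>n. norm (f n t))"
  proof (intro AE_I2)
    fix t assume "t \<in> space lborel_pos"
    hence t: "t > 0" by (simp add: space_restrict_space)
    have "norm (norm (w * complex_of_real (exp (-t)))) < 1" using lt[OF t] by simp
    hence "summable (\<lambda>n. of_nat (Suc n) * norm (w * complex_of_real (exp (-t))) ^ n)"
      using geometric_deriv_sums sums_summable by blast
    hence "summable (\<lambda>n. t powr s * (norm (w * complex_of_real (exp (-t))) * (of_nat (Suc n) * norm (w * complex_of_real (exp (-t))) ^ n)))"
      by (intro summable_mult)
    thus "summable (\<lambda>n. norm (f n t))"
      unfolding f_eq by (simp add: norm_mult norm_power del: of_nat_Suc)
  qed
  have "integrable lborel_pos (\<lambda>t. \<Sum>n. f n t)"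
    by (rule integrable_suminf[OF int_f AE sum_int])
  moreover have "(LINT t|lborel_pos. (\<Sum>n. f n t)) = (\<Sum>n. w ^ Suc n * of_real (G n))"
    unfolding val_f [symmetric] by (rule integral_suminf[OF int_f AE sum_int])
  moreover have "\<dots> = of_real (Gamma (1 + s)) * periodic_zeta w (of_real s)"
    using pz[OF w] by (simp only: sums_iff)
  ultimately have "has_bochner_integral lborel_pos (\<lambda>t. \<Sum>n. f n t) 
                     (of_real (Gamma (1 + s)) * periodic_zeta w (of_real s))"
    by (simp add: has_bochner_integral_iff)
  also have "?this \<longleftrightarrow> ?thesis"
  proof (intro has_bochner_integral_cong refl)
    fix t assume "t \<in> space lborel_pos"
    hence t: "t > 0" by (simp add: space_restrict_space)
    have "(\<lambda>n. f n t) sums (of_real (t powr s) * (w * of_real (exp (-t)) * (1 / (1 - w * of_real (exp (-t)))\<^sup>2)))"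
      unfolding f_eq by (intro sums_mult geometric_deriv_sums lt t)
    thus "(\<Sum>n. f n t) = of_real (t powr s) * (w * of_real (exp (-t)) / (1 - w * of_real (exp (-t)))\<^sup>2)"
      by (simp add: sums_iff)
  qed
  finally show ?thesis .
qed

text \<open>
  The boundary case follows by dominated convergence along r z with r \<rightarrow> 1: the points
  r e^(-t) z all lie on the segment from 0 to z, which has positive distance from the pole
  at 1.
\<close>

lemma has_bochner_integral_periodic_zeta:
  fixes s :: real
  assumes z: "norm z \<le> 1" "z \<noteq> 1" and s: "s > -1"
  shows "has_bochner_integral lborel_pos
           (\<lambda>t. of_real (t powr s) * (z * of_real (exp (-t)) / (1 - z * of_real (exp (-t)))\<^sup>2))
           (of_real (Gamma (1 + s)) * periodic_zeta z (of_real s))"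
proof -
  define r where "r = (\<lambda>k::nat. 1 - 1 / real (k + 2))"
  define h where "h = (\<lambda>w t. of_real (t powr s) * (w * of_real (exp (-t)) / (1 - w * of_real (exp (-t)))\<^sup>2) :: complex)"
  have r: "r k \<ge> 0" "r k < 1" for k by (auto simp: r_def)
  have lim_r: "r \<longlonglongrightarrow> 1"
    unfolding r_def by real_asymp
  have nw: "norm (of_real (r k) * z) < 1" for k
  proof -
    have "r k * norm z \<le> r k * 1" using r[of k] z by (intro mult_left_mono) auto
    thus ?thesis using r[of k] by (simp add: norm_mult)
  qed
  have "1 \<notin> closed_segment 0 z"
  proof
    assume "1 \<in> closed_segment 0 z"
    then obtain u where u: "u \<ge> 0" "u \<le> 1" "1 = u *\<^sub>R z" by (auto simp: in_segment)
    hence "1 = u * norm z" by (metis norm_one norm_scaleR abs_of_nonneg)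
    moreover have "u * norm z \<le> u * 1" using u z by (intro mult_left_mono) auto
    ultimately have "u = 1" using u by simp
    with u z show False by simp
  qed
  then obtain d where d: "d > 0" "\<And>y. y \<in> closed_segment 0 z \<Longrightarrow> d \<le> dist 1 y"
    using separate_point_closed[of "closed_segment 0 z" 1] by auto
  have dist_le: "d \<le> norm (1 - of_real \<rho> * z)" if "0 \<le> \<rho>" "\<rho> \<le> 1" for \<rho> :: real
    using d(2)[of "of_real \<rho> * z"] that by (auto simp: in_segment dist_norm scaleR_conv_of_real)
  have bound: "norm (h (of_real \<rho> * z) t) \<le> (t powr (s + 1 - 1) * exp (-1 * t)) * (1 / d\<^sup>2)"
    if "0 \<le> \<rho>" "\<rho> \<le> 1" "t > 0" for \<rho> t :: real
  proof -
    have "d \<le> norm (1 - of_real \<rho> * z * of_real (exp (-t)))"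
      using dist_le[of "\<rho> * exp (-t)"] that by (simp add: mult_le_one mult_ac)
    hence "1 / (norm (1 - of_real \<rho> * z * of_real (exp (-t))))\<^sup>2 \<le> 1 / d\<^sup>2"
      using d by (intro divide_left_mono power_mono mult_pos_pos zero_less_power) auto
    moreover have "norm (of_real \<rho> * z) \<le> 1" using that z by (simp add: norm_mult mult_le_one)
    ultimately have "(t powr s * exp (-t)) * norm (of_real \<rho> * z) * (1 / (norm (1 - of_real \<rho> * z * of_real (exp (-t))))\<^sup>2)
        \<le> (t powr s * exp (-t)) * 1 * (1 / d\<^sup>2)"
      by (intro mult_mono) auto
    thus ?thesis by (simp add: h_def norm_mult norm_divide norm_power mult_ac)
  qed
  have meas: "h w \<in> borel_measurable lborel_pos" for w
    unfolding h_def by (intro measurable_restrict_space1) measurable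
  have dom: "integrable lborel_pos (\<lambda>t. (t powr (s + 1 - 1) * exp (-1 * t)) * (1 / d\<^sup>2))"
    using has_bochner_integral_Gamma_scaled[of "s + 1" 1] s
    by (intro integrable_mult_left) (auto simp: has_bochner_integral_iff)
  have AE_lim: "AE t in lborel_pos. (\<lambda>k. h (of_real (r k) * z) t) \<longlonglongrightarrow> h z t"
  proof (intro AE_I2)
    fix t assume "t \<in> space lborel_pos"
    hence t: "t > 0" by (simp add: space_restrict_space)
    have "d \<le> norm (1 - z * of_real (exp (-t)))" using dist_le[of "exp (-t)"] t by (simp add: mult_ac)
    hence "1 - of_real 1 * z * of_real (exp (-t)) \<noteq> 0" using d by auto
    hence "(\<lambda>k. h (of_real (r k) * z) t) \<longlonglongrightarrow> h (of_real 1 * z) t"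
      unfolding h_def by (intro tendsto_intros lim_r) auto
    thus "(\<lambda>k. h (of_real (r k) * z) t) \<longlonglongrightarrow> h z t" by simp
  qed
  have AE_bd: "AE t in lborel_pos. norm (h (of_real (r k) * z) t) \<le> (t powr (s + 1 - 1) * exp (-1 * t)) * (1 / d\<^sup>2)" for k
    using r[of k] by (intro AE_I2 bound) (auto simp: space_restrict_space)
  have "integrable lborel_pos (h z)"
    by (rule integrable_dominated_convergence[OF meas meas dom AE_lim AE_bd])
  moreover have "(\<lambda>k. integral\<^sup>L lborel_pos (h (of_real (r k) * z))) \<longlonglongrightarrow> integral\<^sup>L lborel_pos (h z)"
    by (rule integral_dominated_convergence[OF meas meas dom AE_lim AE_bd])
  moreover have "(\<lambda>k. integral\<^sup>L lborel_pos (h (of_real (r k) * z))) = 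
        (\<lambda>k. of_real (Gamma (1 + s)) * periodic_zeta (of_real (r k) * z) (of_real s))"
    using has_bochner_integral_periodic_zeta_in_disc[OF nw s]
    unfolding h_def by (simp add: has_bochner_integral_iff)
  moreover have "(\<lambda>k. of_real (Gamma (1 + s)) * periodic_zeta (of_real (r k) * z) (of_real s)) \<longlonglongrightarrow>
                   of_real (Gamma (1 + s)) * periodic_zeta z (of_real s)"
  proof (intro tendsto_intros tendsto_periodic_zeta)
    have "(\<lambda>k. of_real (r k) * z) \<longlonglongrightarrow> of_real 1 * z" by (intro tendsto_intros lim_r)
    thus "(\<lambda>k. of_real (r k) * z) \<longlonglongrightarrow> z" by simp
  qed (use nw s z less_imp_le in auto)
  ultimately have "integrable lborel_pos (h z)"
      "integral\<^sup>L lborel_pos (h z) = of_real (Gamma (1 + s)) * periodic_zeta z (of_real s)"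
    by (auto intro: LIMSEQ_unique)
  thus ?thesis unfolding h_def by (simp add: has_bochner_integral_iff)
qed

section \<open>The Hurwitz formula\<close>

lemma cis_2pi_neq_1:
  assumes "0 < x" "x < 1"
  shows   "cis (2 * pi * x) \<noteq> 1"
proof
  assume "cis (2 * pi * x) = 1"
  hence "cos (2 * pi * x) = 1" by (simp add: complex_eq_iff)
  then obtain n :: int where "2 * pi * x = of_int n * 2 * pi"
    by (auto simp: cos_one_2pi_int)
  hence "x = of_int n" by simp
  with assms show False by auto
qed

text \<open>
  The partial fraction decomposition is integrated termwise.  The fractions
  with poles on the upper half of the imaginary axis give the series for x, the conjugate
  ones that for 1 - x.
\<close>

lemma periodic_zeta_conv_Hurwitz_series:
  fixes x s :: real
  assumes x: "0 < x" "x < 1" and s: "-1 < s" "s < 0"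
  shows "of_real (Gamma (1 + s)) * periodic_zeta (cis (2 * pi * x)) (of_real s) =
           of_real ((2 * pi) powr (s - 1)) *
             (mellin_const s * of_real (\<Sum>k. (x + real k) powr (s - 1)) +
              cnj (mellin_const s) * of_real (\<Sum>k. (1 - x + real k) powr (s - 1)))"
proof -
  define z where "z = cis (2 * pi * x)"
  define f where "f = (\<lambda>x k t. of_real (t powr s) * (1 / (of_real t - \<i> * of_real (2 * pi * (x + real k)))\<^sup>2))"
  define P where "P = (\<lambda>x. mellin_const s * of_real ((2 * pi) powr (s - 1) * (\<Sum>k. (x + real k) powr (s - 1))))"
  have f: "has_bochner_integral lborel_pos (\<lambda>t. \<Sum>k. f y k t) (P y)" if "y > 0" for y
    using has_bochner_integral_progression(1)[OF that s] unfolding f_def P_def .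
  have summ: "summable (\<lambda>k. f y k t)" if "y > 0" "t > 0" for y t
    using has_bochner_integral_progression(2)[OF that(1) s that(2)] unfolding f_def
    by (rule summable_norm_cancel)
  have "has_bochner_integral lborel_pos (\<lambda>t. (\<Sum>k. f x k t) + cnj (\<Sum>k. f (1 - x) k t)) (P x + cnj (P (1 - x)))"
    using x by (intro has_bochner_integral_add has_bochner_integral_bounded_linear[OF bounded_linear_cnj] f) auto
  also have "?this \<longleftrightarrow> has_bochner_integral lborel_pos 
           (\<lambda>t. of_real (t powr s) * (z * of_real (exp (-t)) / (1 - z * of_real (exp (-t)))\<^sup>2)) (P x + cnj (P (1 - x)))"
  proof (intro has_bochner_integral_cong refl)
    fix t assume "t \<in> space lborel_pos"
    hence t: "t > 0" by (simp add: space_restrict_space)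
    have "(\<lambda>k. f x k t + cnj (f (1 - x) k t)) sums ((\<Sum>k. f x k t) + cnj (\<Sum>k. f (1 - x) k t))"
      using x t by (intro sums_add summable_sums summ sums_cnj[THEN iffD2]) auto
    moreover have "(\<lambda>k. f x k t + cnj (f (1 - x) k t)) sums 
                     (of_real (t powr s) * (z * of_real (exp (-t)) / (1 - z * of_real (exp (-t)))\<^sup>2))"
      using sums_mult[OF kernel_partial_fractions[OF x, of t], of "of_real (t powr s)"]
      by (simp add: f_def z_def distrib_left)
    ultimately show "(\<Sum>k. f x k t) + cnj (\<Sum>k. f (1 - x) k t) =
        of_real (t powr s) * (z * of_real (exp (-t)) / (1 - z * of_real (exp (-t)))\<^sup>2)"
      by (rule sums_unique2)
  qed
  finally have "of_real (Gamma (1 + s)) * periodic_zeta z (of_real s) = P x + cnj (P (1 - x))"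
    using has_bochner_integral_periodic_zeta[of z s] cis_2pi_neq_1[OF x] s
    unfolding z_def by (auto intro: has_bochner_integral_eq)
  thus ?thesis by (simp add: z_def P_def algebra_simps)
qed

text \<open>
  By Hurwitz's formula this is s \<zeta>(1 - s, x).  The factor s removes the pole, and
  \<Gamma>(1 + s) stands for s \<Gamma>(s).
\<close>

definition hurwitz_phi :: "real \<Rightarrow> complex \<Rightarrow> complex" where
  "hurwitz_phi x s = Gamma (1 + s) * of_real (2 * pi) powr (-s) *
     (exp (-\<i> * of_real pi / 2 * s) * periodic_zeta (cis (2 * pi * x)) s +
      exp (\<i> * of_real pi / 2 * s) * periodic_zeta (cnj (cis (2 * pi * x))) s)"

text \<open>
  Replacing x by 1 - x conjugates z and exchanges the two series, so the previous lemma
  gives two linear equations for them.  The combination that occurs in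
  hurwitz_phi eliminates the series for 1 - x.
\<close>

lemma Hurwitz_formula_strip:
  fixes x s :: real
  assumes x: "0 < x" "x < 1" and s: "-1 < s" "s < 0"
  shows "of_real s * of_real (\<Sum>k. (x + real k) powr (s - 1)) = hurwitz_phi x (of_real s)"
proof -
  define e where "e = cis (pi * s / 2)"
  define A where "A = complex_of_real (\<Sum>k. (x + real k) powr (s - 1))"
  define B where "B = complex_of_real (\<Sum>k. (1 - x + real k) powr (s - 1))"
  define p where "p = periodic_zeta (cis (2 * pi * x)) (of_real s)"
  define q where "q = periodic_zeta (cnj (cis (2 * pi * x))) (of_real s)"
  define c where "c = complex_of_real ((2 * pi) powr (s - 1))"
  define r where "r = complex_of_real (pi * s / sin (pi * s))"
  have ee: "e * cnj e = 1" "cnj e * e = 1" by (simp_all add: e_def cis_mult cis_cnj)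
  have ex: "exp (\<i> * of_real pi / 2 * of_real s) = e" "exp (-\<i> * of_real pi / 2 * of_real s) = cnj e"
  proof -
    have q: "\<i> * of_real pi / 2 * of_real s = \<i> * of_real (pi * s / 2)"
      "-\<i> * of_real pi / 2 * of_real s = \<i> * of_real (-(pi * s / 2))" by simp_all
    have "cnj e = cis (-(pi * s / 2))" by (simp add: e_def cis_cnj)
    thus "exp (\<i> * of_real pi / 2 * of_real s) = e" "exp (-\<i> * of_real pi / 2 * of_real s) = cnj e"
      unfolding q by (simp_all only: e_def cis_conv_exp)
  qed
  have m: "mellin_const s = r * \<i> * cnj e" "cnj (mellin_const s) = -r * \<i> * e"
    by (simp_all add: mellin_const_def r_def e_def cis_conv_exp exp_cnj)
  have p: "of_real (Gamma (1 + s)) * p = c * (mellin_const s * A + cnj (mellin_const s) * B)"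
    using periodic_zeta_conv_Hurwitz_series[OF x s] by (simp only: p_def c_def A_def B_def)
  have cc: "cis (2 * pi * (1 - x)) = cnj (cis (2 * pi * x))"
    by (simp add: complex_eq_iff right_diff_distrib cos_diff sin_diff)
  have q: "of_real (Gamma (1 + s)) * q = c * (mellin_const s * B + cnj (mellin_const s) * A)"
    using periodic_zeta_conv_Hurwitz_series[of "1 - x" s] x s
    unfolding cc by (simp add: q_def c_def A_def B_def)
  have sin_nz: "sin (pi * s) \<noteq> 0"
  proof -
    have "pi * (-s) < pi * 1" using s by (intro mult_strict_left_mono) auto
    hence "sin (pi * (-s)) > 0" using s by (intro sin_gt_zero mult_pos_pos) auto
    thus ?thesis by simp
  qed
  \<comment> \<open>The multipliers cnj e and e are the exponentials in hurwitz_phi; with them the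
    coefficient of B cancels.\<close>
  have "cnj e * (of_real (Gamma (1 + s)) * p) + e * (of_real (Gamma (1 + s)) * q) =
          c * r * \<i> * ((cnj e * cnj e - e * e) * A + (e * cnj e - cnj e * e) * B)"
    unfolding p q unfolding m(2) unfolding m(1) by (simp add: algebra_simps)
  also have "e * cnj e - cnj e * e = 0" by simp
  also have "cnj e * cnj e - e * e = -2 * \<i> * of_real (sin (pi * s))"
    by (simp add: e_def cis_mult cis_cnj complex_eq_iff)
  also have "c * r * \<i> * (-2 * \<i> * of_real (sin (pi * s)) * A + 0 * B) = 2 * of_real pi * c * of_real s * A"
    using sin_nz by (simp add: r_def)
  finally have *: "of_real (Gamma (1 + s)) * (cnj e * p + e * q) = 2 * of_real pi * c * of_real s * A"
    by (simp add: algebra_simps)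
  have pw: "of_real (2 * pi) powr (-of_real s) * (2 * of_real pi * c) = (1 :: complex)"
  proof -
    have "(2 * pi) powr (-s) * (2 * pi * (2 * pi) powr (s - 1)) = 1"
      by (simp add: powr_diff powr_minus)
    moreover have "of_real (2 * pi) powr (-of_real s) = complex_of_real ((2 * pi) powr (-s))"
      using powr_of_real[of "2 * pi" "-s"] by simp
    ultimately show ?thesis unfolding c_def
      by (metis of_real_1 of_real_mult of_real_numeral)
  qed
  have "hurwitz_phi x (of_real s) = of_real (2 * pi) powr (-of_real s) * (of_real (Gamma (1 + s)) * (cnj e * p + e * q))"
    unfolding hurwitz_phi_def ex p_def q_def by (simp flip: Gamma_complex_of_real)
  also have "\<dots> = (of_real (2 * pi) powr (-of_real s) * (2 * of_real pi * c)) * (of_real s * A)"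
    unfolding * by (simp only: mult_ac)
  finally show ?thesis unfolding pw by (simp add: A_def)
qed

lemma holomorphic_hurwitz_phi:
  assumes "0 < x" "x < 1"
  shows   "hurwitz_phi x holomorphic_on {s. Re s > -1}"
proof -
  have 1: "cis (2 * pi * x) \<noteq> 1" using assms by (rule cis_2pi_neq_1)
  hence 2: "cnj (cis (2 * pi * x)) \<noteq> 1" by (metis complex_cnj_cnj complex_cnj_one)
  have ni: "1 + s \<notin> \<int>\<^sub>\<le>\<^sub>0" if "Re s > -1" for s
    using that by (auto elim!: nonpos_Ints_cases simp: complex_eq_iff)
  show ?thesis unfolding hurwitz_phi_def
    by (intro holomorphic_intros holomorphic_periodic_zeta) (use 1 2 ni in auto)
qed

lemma holomorphic_hurwitz_phi_reflect:
  assumes "0 < x" "x < 1" "A \<subseteq> {w. Re w < 2}"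
  shows   "(\<lambda>w. hurwitz_phi x (1 - w)) holomorphic_on A"
proof -
  have "(hurwitz_phi x \<circ> (\<lambda>w. 1 - w)) holomorphic_on A"
    by (rule holomorphic_on_compose_gen[OF _ holomorphic_hurwitz_phi[OF assms(1,2)]])
       (use assms in \<open>auto intro!: holomorphic_intros\<close>)
  thus ?thesis by (simp add: o_def)
qed

section \<open>Continuation of the Hurwitz zeta function\<close>

definition hurwitz_series :: "real \<Rightarrow> complex \<Rightarrow> complex" where
  "hurwitz_series x s = (\<Sum>n. (of_nat n + of_real x) powr (-s))"

lemma norm_shifted_powr:
  assumes "x > 0"
  shows   "norm ((of_nat n + of_real x :: complex) powr s) = (x + real n) powr Re s"
proof -
  have "of_nat n + of_real x = complex_of_real (x + real n)" by simp
  thus ?thesis using assms by (subst norm_powr_real_powr) (auto simp: add.commute)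
qed

lemma uniform_limit_hurwitz_series:
  assumes "x > 0" "Re s0 > 1"
  shows "\<exists>d>0. cball s0 d \<subseteq> {s. Re s > 1} \<and>
           uniform_limit (cball s0 d) (\<lambda>N s. \<Sum>n<N. (of_nat n + of_real x) powr (-s)) (hurwitz_series x) sequentially"
proof (intro exI conjI)
  define d where "d = (Re s0 - 1) / 2"
  have re: "Re s \<ge> 1 + d" if "s \<in> cball s0 d" for s
    using that abs_Re_le_cmod[of "s0 - s"] by (auto simp: dist_norm d_def field_simps)
  show "d > 0" using assms by (simp add: d_def)
  with re show "cball s0 d \<subseteq> {s. Re s > 1}" by force
  show "uniform_limit (cball s0 d) (\<lambda>N s. \<Sum>n<N. (of_nat n + of_real x) powr (-s)) (hurwitz_series x) sequentially"
    unfolding hurwitz_series_def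
  proof (rule Weierstrass_m_test_ev)
    show "\<forall>\<^sub>F n in sequentially. \<forall>s\<in>cball s0 d. norm ((of_nat n + of_real x) powr (-s)) \<le> (x + real n) powr (-(1 + d))"
      using eventually_gt_at_top[of 0]
    proof eventually_elim
      case (elim n)
      show ?case
      proof
        fix s assume "s \<in> cball s0 d"
        hence "-Re s \<le> -(1 + d)" using re[of s] by simp
        thus "norm ((of_nat n + of_real x) powr (-s)) \<le> (x + real n) powr (-(1 + d))"
          using assms elim by (auto simp: norm_shifted_powr intro!: powr_mono)
      qed
    qed
    show "summable (\<lambda>n. (x + real n) powr (-(1 + d)))"
      using assms \<open>d > 0\<close> by (intro summable_shifted_powr) auto
  qed
qed

lemma holomorphic_hurwitz_series:
  assumes "x > 0"
  shows   "hurwitz_series x holomorphic_on {s. Re s > 1}"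
proof (rule holomorphic_uniform_sequence)
  show "open {s. Re s > 1}" by (simp add: open_halfspace_Re_gt)
  have "of_nat n + complex_of_real x \<noteq> 0" for n
    using assms by (auto simp: complex_eq_iff)
  thus "(\<lambda>s. \<Sum>n<N. (of_nat n + of_real x) powr (-s)) holomorphic_on {s. Re s > 1}" for N
    by (intro holomorphic_intros)
qed (use uniform_limit_hurwitz_series[OF assms] in auto)

lemma hurwitz_series_sums:
  assumes "x > 0" "Re s > 1"
  shows   "(\<lambda>n. (of_nat n + of_real x) powr (-s)) sums hurwitz_series x s"
proof -
  obtain d where "d > 0" "uniform_limit (cball s d) (\<lambda>N s. \<Sum>n<N. (of_nat n + of_real x) powr (-s)) (hurwitz_series x) sequentially"
    using uniform_limit_hurwitz_series[OF assms] by blast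
  from tendsto_uniform_limitI[OF this(2), of s] \<open>d > 0\<close> show ?thesis
    by (simp add: sums_def)
qed

text \<open>
  The uniqueness half of the definite description, by the identity theorem.
\<close>

lemma hurwitz_zeta_eqI:
  assumes "f holomorphic_on (-{1})"
    and "\<And>s. Re s > 1 \<Longrightarrow> (\<lambda>n. (of_nat n + of_real x) powr (-s)) sums f s"
    and "f 1 = 0"
  shows "hurwitz_zeta x = f"
  unfolding hurwitz_zeta_def
proof (rule the_equality)
  fix g assume g: "g holomorphic_on (-{1}) \<and> (\<forall>s. Re s > 1 \<longrightarrow> (\<lambda>n. (of_nat n + of_real x) powr (-s)) sums g s) \<and> g 1 = 0"
  show "g = f"
  proof
    fix w :: complex
    show "g w = f w"
    proof (cases "w = 1")
      case False
      show ?thesis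
      proof (rule analytic_continuation_open[where f = g and g = f])
        show "connected (- {1 :: complex})" by (intro connected_punctured_universe) auto
        show "{s :: complex. Re s > 1} \<noteq> {}" by (auto intro: exI[of _ 2])
        show "g s = f s" if "s \<in> {s. Re s > 1}" for s
          using that assms(2)[of s] g sums_unique2 by blast
      qed (use False g assms(1) in \<open>auto simp: open_halfspace_Re_gt\<close>)
    qed (use g assms in auto)
  qed
qed (use assms in auto)

lemma of_real_islimpt_greaterThanLessThan:
  fixes a b c :: real
  assumes "a < c" "c < b"
  shows   "complex_of_real c islimpt (complex_of_real ` {a<..<b})"
  unfolding islimpt_approachable
proof (intro allI impI)
  fix e :: real assume e: "e > 0"
  define y where "y = c + min (e / 2) ((b - c) / 2)"
  have "y \<in> {a<..<b}" "y \<noteq> c" "\<bar>y - c\<bar> < e" using assms e by (auto simp: y_def min_def field_simps)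
  thus "\<exists>x'\<in>complex_of_real ` {a<..<b}. x' \<noteq> of_real c \<and> dist x' (of_real c) < e"
    by (intro bexI[of _ "of_real y"]) (auto simp: dist_of_real dist_real_def)
qed

text \<open>
  Both sides are holomorphic in the strip, and on its real points s = 1 - w lies between
  -1 and 0, where the formula has been established.
\<close>

lemma hurwitz_series_eq_phi:
  assumes x: "0 < x" "x < 1" and w: "1 < Re w" "Re w < 2"
  shows   "hurwitz_series x w = hurwitz_phi x (1 - w) / (1 - w)"
proof -
  define S where "S = {w. 1 < Re w \<and> Re w < 2}"
  have S: "S = {w. 1 < Re w} \<inter> {w. Re w < 2}" by (auto simp: S_def)
  have phi: "(\<lambda>w. hurwitz_phi x (1 - w)) holomorphic_on S"
    using x by (rule holomorphic_hurwitz_phi_reflect) (auto simp: S_def)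
  have "hurwitz_series x w - hurwitz_phi x (1 - w) / (1 - w) = 0"
  proof (rule analytic_continuation[where S = S and U = "of_real ` {1<..<2}" and \<xi> = "of_real (3 / 2)"
            and f = "\<lambda>w. hurwitz_series x w - hurwitz_phi x (1 - w) / (1 - w)" and w = w])
    have "hurwitz_series x holomorphic_on S"
      by (rule holomorphic_on_subset[OF holomorphic_hurwitz_series]) (use x in \<open>auto simp: S_def\<close>)
    thus "(\<lambda>w. hurwitz_series x w - hurwitz_phi x (1 - w) / (1 - w)) holomorphic_on S"
      by (intro holomorphic_intros phi) (auto simp: S_def)
    show "open S" unfolding S by (intro open_Int open_halfspace_Re_gt open_halfspace_Re_lt)
    show "connected S" unfolding S
      by (intro convex_connected convex_Int convex_halfspace_Re_gt convex_halfspace_Re_lt)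
    \<comment> \<open>Any point of the open interval serves as the accumulation point.\<close>
    show "of_real (3 / 2) islimpt (complex_of_real ` {1<..<2})" by (rule of_real_islimpt_greaterThanLessThan) auto
    fix z assume "z \<in> complex_of_real ` {1<..<2}"
    then obtain y where y: "z = of_real y" "1 < y" "y < 2" by auto
    have "(\<lambda>n. (of_nat n + of_real x) powr (-z)) sums hurwitz_series x z"
      using x y by (intro hurwitz_series_sums) auto
    also have "(\<lambda>n. (of_nat n + of_real x) powr (-z)) = (\<lambda>n. of_real ((x + real n) powr (-y)))"
    proof
      fix n
      show "(of_nat n + of_real x) powr (-z) = of_real ((x + real n) powr (-y))"
        using powr_of_real[of "x + real n" "-y"] x y by (simp add: add_ac)
    qed
    finally have "hurwitz_series x z = (\<Sum>n. of_real ((x + real n) powr (-y)))"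
      by (simp add: sums_iff)
    also have "\<dots> = of_real (\<Sum>n. (x + real n) powr (-y))"
      using x y by (intro suminf_of_real [symmetric] summable_shifted_powr) auto
    also have "(\<Sum>n. (x + real n) powr (-y)) = (\<Sum>n. (x + real n) powr ((1 - y) - 1))" by simp
    finally have "of_real (1 - y) * hurwitz_series x z = hurwitz_phi x (of_real (1 - y))"
      using Hurwitz_formula_strip[OF x, of "1 - y"] y by simp
    moreover have "complex_of_real (1 - y) \<noteq> 0" using y by simp
    ultimately have "hurwitz_series x z = hurwitz_phi x (of_real (1 - y)) / of_real (1 - y)"
      by (metis nonzero_mult_div_cancel_left)
    thus "hurwitz_series x z - hurwitz_phi x (1 - z) / (1 - z) = 0"
      by (simp add: y)
  qed (use w in \<open>auto simp: S_def\<close>)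
  thus ?thesis by simp
qed

text \<open>
  The series for Re w > 1 and hurwitz_phi x (1 - w) / (1 - w) for Re w < 2 agree on the
  common strip and together cover the whole punctured plane: Hurwitz's formula is itself
  the analytic continuation.
\<close>

lemma hurwitz_zeta_properties:
  assumes x: "0 < x" "x < 1"
  shows hurwitz_zeta_holomorphic: "hurwitz_zeta x holomorphic_on (-{1})"
    and hurwitz_zeta_conv_series: "\<And>w. Re w > 1 \<Longrightarrow> hurwitz_zeta x w = hurwitz_series x w"
    and Hurwitz_formula: "\<And>w. Re w < 2 \<Longrightarrow> w \<noteq> 1 \<Longrightarrow> hurwitz_zeta x w = hurwitz_phi x (1 - w) / (1 - w)"
proof -
  define f where "f = (\<lambda>w. if w = 1 then 0 else if Re w > 1 then hurwitz_series x w else hurwitz_phi x (1 - w) / (1 - w))"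
  have f1: "f w = hurwitz_series x w" if "Re w > 1" for w using that by (auto simp: f_def)
  have f2: "f w = hurwitz_phi x (1 - w) / (1 - w)" if "Re w < 2" "w \<noteq> 1" for w
    using that hurwitz_series_eq_phi[OF x, of w] by (auto simp: f_def)
  have "f holomorphic_on ({w. Re w > 1} \<union> ({w. Re w < 2} - {1}))"
  proof (rule holomorphic_on_Un)
    show "f holomorphic_on {w. Re w > 1}"
      using holomorphic_hurwitz_series[OF x(1)] by (rule holomorphic_transform) (simp add: f1)
    have "(\<lambda>w. hurwitz_phi x (1 - w)) holomorphic_on {w. Re w < 2} - {1}"
      using x by (rule holomorphic_hurwitz_phi_reflect) auto
    hence "(\<lambda>w. hurwitz_phi x (1 - w) / (1 - w)) holomorphic_on {w. Re w < 2} - {1}"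
      by (intro holomorphic_intros) auto
    thus "f holomorphic_on {w. Re w < 2} - {1}"
      by (rule holomorphic_transform) (simp add: f2)
  qed (auto simp: open_halfspace_Re_gt open_halfspace_Re_lt)
  also have "{w. Re w > 1} \<union> ({w. Re w < 2} - {1}) = -{1}" by auto
  finally have hol: "f holomorphic_on -{1}" .
  have eq: "hurwitz_zeta x = f"
    using x by (intro hurwitz_zeta_eqI hol) (auto simp: f1 hurwitz_series_sums, simp add: f_def)
  show "hurwitz_zeta x holomorphic_on (-{1})" "\<And>w. Re w > 1 \<Longrightarrow> hurwitz_zeta x w = hurwitz_series x w"
     "\<And>w. Re w < 2 \<Longrightarrow> w \<noteq> 1 \<Longrightarrow> hurwitz_zeta x w = hurwitz_phi x (1 - w) / (1 - w)"
    unfolding eq using hol f1 f2 by auto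
qed

section \<open>The Riemann zeta function\<close>

text \<open>
  Split the integers into even and odd ones: the even part of the series is 2^(-w) times
  the whole, the odd part is 2^(-w) times the series at x = 1/2, and the alternating series
  is their difference.
\<close>

lemma half_and_alternating_zeta:
  assumes w: "Re w > 1"
  shows "periodic_zeta (-1) w = (2 powr (1 - w) - 1) * hurwitz_series 1 w"
    and "hurwitz_series (1/2) w = (2 powr w - 1) * hurwitz_series 1 w"
proof -
  define a where "a = (\<lambda>m::nat. of_nat m powr (-w) :: complex)"
  define T where "T = hurwitz_series 1 w"
  have "(\<lambda>n. a (Suc n)) sums T"
    using hurwitz_series_sums[of 1 w] w by (simp add: a_def T_def add_ac)
  hence T: "a sums T" by (subst (asm) sums_Suc_iff) (simp add: a_def)
  have pz: "(\<lambda>m. (-1) ^ m * a m) sums periodic_zeta (-1) w"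
    using higher_deriv_periodic_zeta_sums[of "-1" w 0] w by (simp add: a_def)
  have grp: "(\<lambda>n. f (2 * n) + f (2 * n + 1)) sums L" if "f sums L" for f :: "nat \<Rightarrow> complex" and L
    using sums_group[OF that, of 2] by (simp add: mult.commute eval_nat_numeral)
  have even: "a (2 * n) = 2 powr (-w) * a n" for n
    using powr_times_real[of 2 "of_nat n" "-w"] by (simp add: a_def)
  have Ev: "(\<lambda>n. a (2 * n)) sums (2 powr (-w) * T)" unfolding even by (intro sums_mult T)
  have Od: "(\<lambda>n. a (2 * n + 1)) sums (T - 2 powr (-w) * T)"
    using sums_diff[OF grp[OF T] Ev] by simp
  have "(\<lambda>n. a (2 * n) - a (2 * n + 1)) sums periodic_zeta (-1) w"
    using grp[OF pz] by simp
  moreover have "(\<lambda>n. a (2 * n) - a (2 * n + 1)) sums (2 powr (-w) * T - (T - 2 powr (-w) * T))"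
    by (intro sums_diff Ev Od)
  ultimately have "periodic_zeta (-1) w = 2 powr (-w) * T - (T - 2 powr (-w) * T)"
    by (rule sums_unique2)
  also have "\<dots> = (2 powr (1 - w) - 1) * T"
    by (simp add: powr_diff powr_minus field_simps)
  finally show "periodic_zeta (-1) w = (2 powr (1 - w) - 1) * hurwitz_series 1 w"
    by (simp add: T_def)
  have "(\<lambda>n. 2 powr w * a (2 * n + 1)) sums (2 powr w * (T - 2 powr (-w) * T))"
    by (intro sums_mult Od)
  also have "2 powr w * (T - 2 powr (-w) * T) = (2 powr w - 1) * T"
    by (simp add: powr_minus field_simps)
  also have "(\<lambda>n. 2 powr w * a (2 * n + 1)) = (\<lambda>n. (of_nat n + of_real (1/2)) powr (-w))"
  proof
    fix n
    have "a (2 * n + 1) = (of_real 2 * of_real (real n + 1/2)) powr (-w)"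
      by (simp add: a_def algebra_simps)
    also have "\<dots> = of_real 2 powr (-w) * of_real (real n + 1/2) powr (-w)"
      by (intro powr_times_real) auto
    finally show "2 powr w * a (2 * n + 1) = (of_nat n + of_real (1/2)) powr (-w)"
      by (simp add: powr_minus field_simps)
  qed
  finally show "hurwitz_series (1/2) w = (2 powr w - 1) * hurwitz_series 1 w"
    using hurwitz_series_sums[of "1/2" w] w unfolding T_def by (auto intro: sums_unique2)
qed

lemma two_powr_neq_1:
  assumes "Re w \<noteq> 0"
  shows   "(2 :: complex) powr w \<noteq> 1"
proof
  assume "(2 :: complex) powr w = 1"
  hence "norm ((2 :: complex) powr w) = 1" by simp
  hence "2 powr Re w = (1 :: real)" using norm_powr_real_powr[of 2 w] by simp
  with assms show False by simp
qed

text \<open>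
  For x = 1 the point z equals 1, where periodic_zeta is not available.  The continuation is
  therefore glued from two quotients, one with denominator 2^w - 1, which can vanish only on the line
  Re w = 0, and one with denominator 2^(1 - w) - 1, which can vanish only on the line
  Re w = 1.
\<close>

lemma riemann_zeta_conv_series:
  assumes "Re s > 1"
  shows   "riemann_zeta s = hurwitz_series 1 s"
proof -
  define Z where "Z = hurwitz_zeta (1/2)"
  have Z: "Z holomorphic_on -{1}" "\<And>w. Re w > 1 \<Longrightarrow> Z w = hurwitz_series (1/2) w"
    using hurwitz_zeta_properties[of "1/2"] by (auto simp: Z_def)
  have pz: "periodic_zeta (-1) holomorphic_on {w. Re w > -1}"
    by (rule holomorphic_periodic_zeta) auto
  have agree: "(2 powr w - 1) * periodic_zeta (-1) w = (2 powr (1 - w) - 1) * Z w"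
    if "Re w > -1" "w \<noteq> 1" for w
  proof (rule analytic_continuation_open[where f = "\<lambda>w. (2 powr w - 1) * periodic_zeta (-1) w" and g = "\<lambda>w. (2 powr (1 - w) - 1) * Z w"])
    show "{w. Re w > 1} \<noteq> {}" by (auto intro: exI[of _ 2])
    show "connected ({w. Re w > -1} - {1})"
      by (intro connected_open_delete convex_connected convex_halfspace_Re_gt) (auto simp: open_halfspace_Re_gt)
    show "(\<lambda>w. (2 powr w - 1) * periodic_zeta (-1) w) holomorphic_on {w. Re w > -1} - {1}"
      by (intro holomorphic_intros holomorphic_on_subset[OF pz]) auto
    show "(\<lambda>w. (2 powr (1 - w) - 1) * Z w) holomorphic_on {w. Re w > -1} - {1}"
      by (intro holomorphic_intros holomorphic_on_subset[OF Z(1)]) auto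
    show "(2 powr z - 1) * periodic_zeta (-1) z = (2 powr (1 - z) - 1) * Z z" if "z \<in> {w. Re w > 1}" for z
      using that Z(2)[of z] half_and_alternating_zeta[of z] by simp
  qed (use that in \<open>auto simp: open_halfspace_Re_gt\<close>)
  \<comment> \<open>The value 0 at the pole is the one that the definition of hurwitz_zeta prescribes.\<close>
  define f where "f = (\<lambda>w. if w = 1 then 0 else if Re w = 0 then periodic_zeta (-1) w / (2 powr (1 - w) - 1)
                         else Z w / (2 powr w - 1))"
  have f1: "f w = Z w / (2 powr w - 1)" if "w \<noteq> 1" "Re w \<noteq> 0" for w using that by (auto simp: f_def)
  have f2: "f w = periodic_zeta (-1) w / (2 powr (1 - w) - 1)" if "-1 < Re w" "Re w < 1" for w
  proof (cases "Re w = 0")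
    case False
    thus ?thesis using that agree[of w] two_powr_neq_1[of w] two_powr_neq_1[of "1 - w"]
      by (auto simp: f_def field_simps)
  qed (use that in \<open>auto simp: f_def\<close>)
  have "f holomorphic_on ({w. -1 < Re w \<and> Re w < 1} \<union> ({w. Re w \<noteq> 0} - {1}))"
  proof (rule holomorphic_on_Un)
    have "(\<lambda>w. periodic_zeta (-1) w / (2 powr (1 - w) - 1)) holomorphic_on {w. -1 < Re w \<and> Re w < 1}"
      using two_powr_neq_1 by (intro holomorphic_intros holomorphic_on_subset[OF pz]) auto
    thus "f holomorphic_on {w. -1 < Re w \<and> Re w < 1}"
      by (rule holomorphic_transform) (simp add: f2)
    have "(\<lambda>w. Z w / (2 powr w - 1)) holomorphic_on {w. Re w \<noteq> 0} - {1}"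
      using two_powr_neq_1 by (intro holomorphic_intros holomorphic_on_subset[OF Z(1)]) auto
    thus "f holomorphic_on {w. Re w \<noteq> 0} - {1}"
      by (rule holomorphic_transform) (simp add: f1)
    have "{w. -1 < Re w \<and> Re w < 1} = {w. Re w > -1} \<inter> {w. Re w < 1}" by auto
    thus "open {w. -1 < Re w \<and> Re w < 1}" by (simp add: open_Int open_halfspace_Re_gt open_halfspace_Re_lt)
    have "{w. Re w \<noteq> 0} = {w. Re w > 0} \<union> {w. Re w < 0}" by auto
    thus "open ({w. Re w \<noteq> 0} - {1})" by (simp add: open_Un open_halfspace_Re_gt open_halfspace_Re_lt open_Diff)
  qed
  also have "{w. -1 < Re w \<and> Re w < 1} \<union> ({w. Re w \<noteq> 0} - {1}) = -{1}" by auto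
  finally have hol: "f holomorphic_on -{1}" .
  have f3: "f w = hurwitz_series 1 w" if "Re w > 1" for w
    using that half_and_alternating_zeta(2)[of w] two_powr_neq_1[of w] f1[of w] Z(2)[of w] by (cases "w = 1") auto
  have "hurwitz_zeta 1 = f"
    using hol by (rule hurwitz_zeta_eqI) (use hurwitz_series_sums[of 1] f3 in \<open>auto simp: f_def\<close>)
  thus ?thesis using f3[OF assms] by (simp add: riemann_zeta_def)
qed

lemma riemann_zeta_2: "riemann_zeta 2 = of_real (pi\<^sup>2 / 6)"
proof -
  have "(\<lambda>n. (of_nat n + of_real 1) powr (-2)) sums riemann_zeta 2"
    using hurwitz_series_sums[of 1 2] by (simp add: riemann_zeta_conv_series)
  also have "(\<lambda>n. (of_nat n + of_real 1) powr (-2 :: complex)) = (\<lambda>n. of_real (1 / (real n + 1)\<^sup>2))"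
  proof
    fix n :: nat
    have "(of_nat n + of_real 1 :: complex) powr (-2) = of_real ((real n + 1) powr (-2))"
      using powr_of_real[of "real n + 1" "-2"] by simp
    also have "(real n + 1) powr (-2) = 1 / (real n + 1)\<^sup>2"
      by (simp add: powr_minus powr_numeral field_simps)
    finally show "(of_nat n + of_real 1 :: complex) powr (-2) = of_real (1 / (real n + 1)\<^sup>2)" .
  qed
  finally have "(\<lambda>n. complex_of_real (1 / (real n + 1)\<^sup>2)) sums riemann_zeta 2" .
  moreover have "(\<lambda>n. complex_of_real (1 / (real n + 1)\<^sup>2)) sums of_real (pi\<^sup>2 / 6)"
    using inverse_squares_sums by (subst sums_of_real_iff) (simp add: add_ac)
  ultimately show ?thesis by (rule sums_unique2)
qed

section \<open>Taylor coefficients at the pole\<close>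

text \<open>
  With v = w - 1 the Hurwitz formula reads \<zeta>(1 + v, x) = -hurwitz_phi x (-v) / v, so the
  coefficient of v is minus the second Taylor coefficient of hurwitz_phi x.  The sign
  (-1)^1 in the definition of the Stieltjes constants cancels the minus.
\<close>

lemma stieltjes_gamma_1_eq:
  assumes x: "0 < x" "x < 1"
  shows   "stieltjes_gamma 1 x = (deriv ^^ 2) (hurwitz_phi x) 0 / 2"
proof -
  define S where "S = {s::complex. Re s > -1}"
  define G where "G = (\<lambda>v. hurwitz_phi x (-1 * v))"
  have S: "open S" "0 \<in> S" by (auto simp: S_def open_halfspace_Re_gt)
  have phi: "hurwitz_phi x holomorphic_on S" unfolding S_def using x by (rule holomorphic_hurwitz_phi)
  have oT: "open {s::complex. Re s < 1}" by (simp add: open_halfspace_Re_lt)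
  have "(hurwitz_phi x \<circ> (\<lambda>v. -1 * v)) holomorphic_on {s. Re s < 1}"
    by (rule holomorphic_on_compose_gen[OF _ phi]) (auto intro!: holomorphic_intros simp: S_def)
  hence hol: "G holomorphic_on {s. Re s < 1}" by (simp add: G_def o_def)
  hence fps: "G has_fps_expansion fps_expansion G 0"
    using oT by (intro has_fps_expansion_fps_expansion) auto
  have "(deriv ^^ 2) G 0 = (-1) ^ 2 * (deriv ^^ 2) (hurwitz_phi x) (-1 * 0)"
    unfolding G_def using S oT
    by (intro higher_deriv_compose_linear[OF phi, where S = "{s. Re s < 1}"]) (auto simp: S_def)
  hence dG: "(deriv ^^ 2) G 0 = (deriv ^^ 2) (hurwitz_phi x) 0" by simp
  have "(\<lambda>v. -(G v * v powi (-1))) has_laurent_expansion -(fls_shift 1 (fps_to_fls (fps_expansion G 0)))"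
    by (intro laurent_expansion_intros has_laurent_expansion_fps fps)
  also have "?this \<longleftrightarrow> (\<lambda>v. hurwitz_zeta x (1 + v)) has_laurent_expansion -(fls_shift 1 (fps_to_fls (fps_expansion G 0)))"
  proof (rule has_laurent_expansion_cong)
    have "eventually (\<lambda>v. v \<in> {s. Re s < 1} - {0}) (at (0 :: complex))"
      using oT by (intro eventually_at_in_open) auto
    thus "eventually (\<lambda>v. -(G v * v powi (-1)) = hurwitz_zeta x (1 + v)) (at 0)"
    proof eventually_elim
      case (elim v)
      thus ?case using Hurwitz_formula[OF x, of "1 + v"]
        by (auto simp: G_def power_int_minus field_simps)
    qed
  qed auto
  finally have "laurent_expansion (hurwitz_zeta x) 1 = -(fls_shift 1 (fps_to_fls (fps_expansion G 0)))"
    by (rule laurent_expansion_eqI)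
  hence "stieltjes_gamma 1 x = fps_nth (fps_expansion G 0) 2"
    by (simp add: stieltjes_gamma_def)
  also have "\<dots> = (deriv ^^ 2) G 0 / fact 2" using fps by (rule fps_nth_fps_expansion)
  finally show ?thesis unfolding dG by simp
qed

lemma Polygamma_1_1: "Polygamma 1 (1 :: complex) = of_real (pi\<^sup>2 / 6)"
proof -
  have "(\<lambda>k. inverse ((1 + of_nat k) ^ Suc 1)) sums ((-1) ^ Suc 1 * Polygamma 1 (1 :: complex) / fact 1)"
    by (rule Polygamma_LIMSEQ) auto
  also have "(\<lambda>k. inverse ((1 + of_nat k) ^ Suc 1) :: complex) = (\<lambda>k. of_real (1 / (real k + 1)\<^sup>2))"
    by (simp add: fun_eq_iff power2_eq_square field_simps)
  finally have "(\<lambda>k. complex_of_real (1 / (real k + 1)\<^sup>2)) sums Polygamma 1 (1 :: complex)" by simp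
  moreover have "(\<lambda>n. complex_of_real (1 / (real n + 1)\<^sup>2)) sums of_real (pi\<^sup>2 / 6)"
    using inverse_squares_sums by (subst sums_of_real_iff) (simp add: add_ac)
  ultimately show ?thesis by (rule sums_unique2)
qed

lemma higher_deriv_exp_linear:
  "(deriv ^^ n) (\<lambda>s. exp (c * s)) = (\<lambda>s. c ^ n * exp (c * s :: complex))"
proof (induction n)
  case (Suc n)
  have "deriv (\<lambda>s. c ^ n * exp (c * s)) = (\<lambda>s. c ^ Suc n * exp (c * s))"
    by (intro ext DERIV_imp_deriv) (auto intro!: derivative_eq_intros)
  thus ?case by (simp add: Suc.IH)
qed auto

lemma deriv_Gamma_1_plus:
  "deriv (\<lambda>s. Gamma (1 + s :: complex)) 0 = -euler_mascheroni"
  "(deriv ^^ 2) (\<lambda>s. Gamma (1 + s :: complex)) 0 = euler_mascheroni\<^sup>2 + of_real (pi\<^sup>2 / 6)"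
proof -
  define S where "S = {s::complex. Re s > -1}"
  have ni: "1 + s \<notin> \<int>\<^sub>\<le>\<^sub>0" if "s \<in> S" for s
    using that by (auto elim!: nonpos_Ints_cases simp: complex_eq_iff S_def)
  have D: "deriv (\<lambda>s. Gamma (1 + s)) s = Gamma (1 + s) * Digamma (1 + s)" if "s \<in> S" for s
    using ni[OF that] by (intro DERIV_imp_deriv) (auto intro!: derivative_eq_intros)
  have S: "open S" "0 \<in> S" by (auto simp: S_def open_halfspace_Re_gt)
  show "deriv (\<lambda>s. Gamma (1 + s :: complex)) 0 = -euler_mascheroni"
    using D[OF S(2)] by simp
  have "(deriv ^^ 2) (\<lambda>s. Gamma (1 + s :: complex)) 0 = deriv (deriv (\<lambda>s. Gamma (1 + s))) 0"
    by (simp add: numeral_2_eq_2)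
  also have "\<dots> = deriv (\<lambda>s. Gamma (1 + s) * Digamma (1 + s)) 0"
    using eventually_nhds_in_open[OF S] by (intro deriv_cong_ev) (auto elim!: eventually_mono simp: D)
  also have "\<dots> = Gamma (1 + 0) * Digamma (1 + 0) * Digamma (1 + 0) + Gamma (1 + 0) * Polygamma 1 (1 + 0)"
    using ni[OF S(2)] by (intro DERIV_imp_deriv) (auto intro!: derivative_eq_intros)
  finally show "(deriv ^^ 2) (\<lambda>s. Gamma (1 + s :: complex)) 0 = euler_mascheroni\<^sup>2 + of_real (pi\<^sup>2 / 6)"
    by (simp add: Polygamma_1_1 power2_eq_square del: One_nat_def)
qed

lemma deriv2_mult:
  assumes "f holomorphic_on S" "g holomorphic_on S" "open S" "z \<in> S"
  shows "deriv (\<lambda>w. f w * g w) z = f z * deriv g z + deriv f z * g z"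
    and "(deriv ^^ 2) (\<lambda>w. f w * g w) z = 
           f z * (deriv ^^ 2) g z + 2 * deriv f z * deriv g z + (deriv ^^ 2) f z * g z"
  using higher_deriv_mult[OF assms, of 1] higher_deriv_mult[OF assms, of 2]
  by (simp_all add: numeral_2_eq_2)

section \<open>The three trigonometric series\<close>

text \<open>
  The derivatives of order m of the functions represented by the sums of cos(2 pi n x) n^(-s) and, in the
  next definition, of sin(2 pi n x) n^(-s).  Both are taken as complex functions, so that they are
  defined and holomorphic around s = 0, where the series no longer represent them.
\<close>

definition cos_part :: "real \<Rightarrow> nat \<Rightarrow> complex \<Rightarrow> complex" where
  "cos_part x m s = ((deriv ^^ m) (periodic_zeta (cis (2 * pi * x))) s + (deriv ^^ m) (periodic_zeta (cnj (cis (2 * pi * x)))) s) / 2"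

definition sin_part :: "real \<Rightarrow> nat \<Rightarrow> complex \<Rightarrow> complex" where
  "sin_part x m s = ((deriv ^^ m) (periodic_zeta (cis (2 * pi * x))) s - (deriv ^^ m) (periodic_zeta (cnj (cis (2 * pi * x)))) s) / (2 * \<i>)"

lemma cnj_cis_2pi_neq_1:
  assumes "0 < x" "x < 1"
  shows   "cnj (cis (2 * pi * x)) \<noteq> 1"
  using cis_2pi_neq_1[OF assms] by (metis complex_cnj_cnj complex_cnj_one)

lemma isCont_cos_sin_part:
  assumes x: "0 < x" "x < 1"
  shows "isCont (cos_part x m) 0" "isCont (sin_part x m) 0"
proof -
  have S: "open {s::complex. Re s > -1}" by (simp add: open_halfspace_Re_gt)
  have cont: "isCont ((deriv ^^ m) (periodic_zeta z)) 0" if "norm z \<le> 1" "z \<noteq> 1" for z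
  proof -
    have "(deriv ^^ m) (periodic_zeta z) holomorphic_on {s. Re s > -1}"
      using holomorphic_periodic_zeta[OF that] S by (rule holomorphic_higher_deriv)
    hence "continuous_on {s. Re s > -1} ((deriv ^^ m) (periodic_zeta z))"
      by (rule holomorphic_on_imp_continuous_on)
    thus ?thesis using S by (auto simp: continuous_on_eq_continuous_at)
  qed
  have "isCont ((deriv ^^ m) (periodic_zeta (cis (2 * pi * x)))) 0"
    "isCont ((deriv ^^ m) (periodic_zeta (cnj (cis (2 * pi * x))))) 0"
    using cis_2pi_neq_1[OF x] cnj_cis_2pi_neq_1[OF x] by (intro cont; simp)+
  thus "isCont (cos_part x m) 0" "isCont (sin_part x m) 0"
    unfolding cos_part_def[abs_def] sin_part_def[abs_def] by (intro continuous_intros; simp)+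
qed

text \<open>
  The algebraic heart of the theorem: the Gamma factor and the power of 2 pi have the
  expansion 1 - a s + (a^2 + pi^2/6) s^2 / 2, and the two exponentials combine the values at z
  and 1/z into cosine and sine parts.  The contribution pi^2/6 of \<Gamma> and
  the contribution -pi^2/4 of the exponentials add up to -\<zeta>(2)/2.
\<close>

lemma deriv2_hurwitz_phi:
  assumes x: "0 < x" "x < 1"
  defines "a \<equiv> complex_of_real (euler_mascheroni + ln (2 * pi))"
  shows "(deriv ^^ 2) (hurwitz_phi x) 0 / 2 =
     (a\<^sup>2 * cos_part x 0 0 - 2 * a * cos_part x 1 0 + cos_part x 2 0)
     - 1 / 2 * of_real (pi\<^sup>2 / 6) * cos_part x 0 0
     - of_real pi * (a * sin_part x 0 0 - sin_part x 1 0)"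
proof -
  define S where "S = {s::complex. Re s > -1}"
  have S: "open S" "0 \<in> S" by (auto simp: S_def open_halfspace_Re_gt)
  define z where "z = cis (2 * pi * x)"
  define L where "L = complex_of_real (ln (2 * pi))"
  define g where "g = (\<lambda>s. Gamma (1 + s :: complex))"
  define e where "e = (\<lambda>c s. exp (c * s :: complex))"
  define c where "c = \<i> * of_real pi / 2"
  define F where "F = periodic_zeta z"
  define F' where "F' = periodic_zeta (cnj z)"
  have ni: "1 + s \<notin> \<int>\<^sub>\<le>\<^sub>0" if "s \<in> S" for s
    using that by (auto elim!: nonpos_Ints_cases simp: complex_eq_iff S_def)
  have hg: "g holomorphic_on S" unfolding g_def using ni by (intro holomorphic_intros) auto
  have he: "e k holomorphic_on S" for k unfolding e_def by (intro holomorphic_intros)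
  have hF: "F holomorphic_on S" "F' holomorphic_on S"
    unfolding F_def F'_def S_def z_def using cis_2pi_neq_1[OF x] cnj_cis_2pi_neq_1[OF x]
    by (intro holomorphic_periodic_zeta; simp)+
  have e: "e k 0 = 1" "deriv (e k) 0 = k" "(deriv ^^ 2) (e k) 0 = k\<^sup>2" for k
    using higher_deriv_exp_linear[of 1 k] higher_deriv_exp_linear[of 2 k] unfolding e_def by (auto dest!: fun_cong[of _ _ 0])
  have g: "g 0 = 1" "deriv g 0 = -euler_mascheroni" "(deriv ^^ 2) g 0 = euler_mascheroni\<^sup>2 + of_real (pi\<^sup>2 / 6)"
    unfolding g_def using deriv_Gamma_1_plus by auto
  define k where "k = (\<lambda>s. g s * e (-L) s)"
  define M where "M = (\<lambda>s. e (-c) s * F s + e c s * F' s)"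
  have hk: "k holomorphic_on S" unfolding k_def by (intro holomorphic_intros hg he)
  have hM1: "(\<lambda>s. e (-c) s * F s) holomorphic_on S" "(\<lambda>s. e c s * F' s) holomorphic_on S"
    by (intro holomorphic_intros he hF)+
  have hM: "M holomorphic_on S" unfolding M_def by (intro holomorphic_intros hM1)
  have kv: "k 0 = 1" "deriv k 0 = -a" "(deriv ^^ 2) k 0 = a\<^sup>2 + of_real (pi\<^sup>2 / 6)"
    unfolding k_def using deriv2_mult[OF hg he[of "-L"] S]
    by (simp_all add: e g a_def L_def power2_eq_square algebra_simps of_real_euler_mascheroni)
  define C where "C = (\<lambda>m. cos_part x m 0)"
  define D where "D = (\<lambda>m. sin_part x m 0)"
  have FF: "(deriv ^^ m) F 0 = C m + \<i> * D m" "(deriv ^^ m) F' 0 = C m - \<i> * D m" for m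
    by (simp_all add: C_def D_def cos_part_def sin_part_def F_def F'_def z_def field_simps)
  have F0: "F 0 = C 0 + \<i> * D 0" "F' 0 = C 0 - \<i> * D 0"
    "deriv F 0 = C 1 + \<i> * D 1" "deriv F' 0 = C 1 - \<i> * D 1"
    using FF(1)[of 0] FF(2)[of 0] FF(1)[of 1] FF(2)[of 1] by (simp_all only: funpow.simps One_nat_def o_apply id_apply)
  have M1: "M 0 = 2 * C 0" by (simp add: M_def e F0)
  have "deriv M 0 = deriv (\<lambda>s. e (-c) s * F s) 0 + deriv (\<lambda>s. e c s * F' s) 0"
    unfolding M_def using higher_deriv_add[OF hM1 S, of 1] by simp
  hence M2: "deriv M 0 = 2 * C 1 - 2 * \<i> * c * D 0"
    unfolding deriv2_mult(1)[OF he hF(1) S] deriv2_mult(1)[OF he hF(2) S] e F0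
    by (simp add: algebra_simps)
  have "(deriv ^^ 2) M 0 = (deriv ^^ 2) (\<lambda>s. e (-c) s * F s) 0 + (deriv ^^ 2) (\<lambda>s. e c s * F' s) 0"
    unfolding M_def by (rule higher_deriv_add[OF hM1 S])
  hence M3: "(deriv ^^ 2) M 0 = 2 * C 2 - 4 * \<i> * c * D 1 + 2 * c\<^sup>2 * C 0"
    unfolding deriv2_mult(2)[OF he hF(1) S] deriv2_mult(2)[OF he hF(2) S] e F0 FF
    by (simp add: algebra_simps)
  have phi: "hurwitz_phi x = (\<lambda>s. k s * M s)"
  proof
    fix s
    have "Ln (of_real (2 * pi)) = L" unfolding L_def by (rule Ln_of_real) simp
    hence "of_real (2 * pi) powr (-s) = e (-L) s" by (simp add: powr_def e_def mult.commute)
    moreover have "exp (-\<i> * of_real pi / 2 * s) = e (-c) s" "exp (\<i> * of_real pi / 2 * s) = e c s"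
      by (simp_all add: e_def c_def)
    ultimately show "hurwitz_phi x s = k s * M s"
      by (simp only: hurwitz_phi_def k_def M_def g_def F_def F'_def z_def)
  qed
  have "(deriv ^^ 2) (hurwitz_phi x) 0 = 
     k 0 * (deriv ^^ 2) M 0 + 2 * deriv k 0 * deriv M 0 + (deriv ^^ 2) k 0 * M 0"
    unfolding phi by (rule deriv2_mult[OF hk hM S])
  also have "\<dots> / 2 = (a\<^sup>2 * C 0 - 2 * a * C 1 + C 2) + (c\<^sup>2 + of_real (pi\<^sup>2 / 6)) * C 0
                        - 2 * (\<i> * c) * (D 1 - a * D 0)"
    unfolding kv M1 M2 M3 by (simp add: field_simps)
  also have "\<i> * c = -of_real pi / 2" by (simp add: c_def)
  also have "c\<^sup>2 + of_real (pi\<^sup>2 / 6) = -1 / 2 * of_real (pi\<^sup>2 / 6)"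
    by (simp add: c_def power_mult_distrib power_divide)
  finally show ?thesis by (simp add: C_def D_def algebra_simps)
qed

lemma trig_series_sums:
  fixes x s :: real
  assumes x: "0 < x" "x < 1" and s: "s > 0"
  shows "(\<lambda>k. complex_of_real ((-ln (real (Suc k))) ^ m * cos (2 * pi * real (Suc k) * x) / real (Suc k) powr s))
            sums cos_part x m (of_real s)"
    and "(\<lambda>k. complex_of_real ((-ln (real (Suc k))) ^ m * sin (2 * pi * real (Suc k) * x) / real (Suc k) powr s))
            sums sin_part x m (of_real s)"
proof -
  define z where "z = cis (2 * pi * x)"
  have sums: "(\<lambda>k. w ^ Suc k * of_real (-ln (real (Suc k))) ^ m * of_nat (Suc k) powr (-of_real s)) sums
                (deriv ^^ m) (periodic_zeta w) (of_real s)" if "norm w \<le> 1" "w \<noteq> 1" for w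
    using higher_deriv_periodic_zeta_sums[OF that, of "of_real s" m] s by (subst sums_Suc_iff) simp
  have z: "norm z \<le> 1" "z \<noteq> 1" "norm (cnj z) \<le> 1" "cnj z \<noteq> 1"
    using cis_2pi_neq_1[OF x] cnj_cis_2pi_neq_1[OF x] by (auto simp: z_def)
  have pw: "of_nat (Suc k) powr (-of_real s) = complex_of_real (1 / real (Suc k) powr s)" for k
    using powr_of_real[of "real (Suc k)" "-s"] by (simp add: powr_minus field_simps)
  have zk: "z ^ Suc k = cis (2 * pi * real (Suc k) * x)" for k
    unfolding z_def by (simp only: Complex.DeMoivre mult_ac)
  have zk': "cnj z ^ Suc k = cnj (cis (2 * pi * real (Suc k) * x))" for k
    by (simp only: zk flip: complex_cnj_power)
  have "(\<lambda>k. (z ^ Suc k * of_real (-ln (real (Suc k))) ^ m * of_nat (Suc k) powr (-of_real s) +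
              cnj z ^ Suc k * of_real (-ln (real (Suc k))) ^ m * of_nat (Suc k) powr (-of_real s)) / 2) sums cos_part x m (of_real s)"
    unfolding cos_part_def z_def[symmetric] by (intro sums_divide sums_add sums z)
  also have "(\<lambda>k. (z ^ Suc k * of_real (-ln (real (Suc k))) ^ m * of_nat (Suc k) powr (-of_real s) +
              cnj z ^ Suc k * of_real (-ln (real (Suc k))) ^ m * of_nat (Suc k) powr (-of_real s)) / 2) = 
     (\<lambda>k. complex_of_real ((-ln (real (Suc k))) ^ m * cos (2 * pi * real (Suc k) * x) / real (Suc k) powr s))"
  proof
    fix k
    define \<theta> where "\<theta> = 2 * pi * real (Suc k) * x"
    define l where "l = (-ln (real (Suc k))) ^ m"
    define p where "p = real (Suc k) powr s"
    show "(z ^ Suc k * of_real (-ln (real (Suc k))) ^ m * of_nat (Suc k) powr (-of_real s) +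
              cnj z ^ Suc k * of_real (-ln (real (Suc k))) ^ m * of_nat (Suc k) powr (-of_real s)) / 2 = 
       complex_of_real ((-ln (real (Suc k))) ^ m * cos (2 * pi * real (Suc k) * x) / real (Suc k) powr s)"
      unfolding zk zk' pw \<theta>_def[symmetric] p_def[symmetric] of_real_power[symmetric] l_def[symmetric]
      by (simp add: complex_eq_iff)
  qed
  finally show "(\<lambda>k. complex_of_real ((-ln (real (Suc k))) ^ m * cos (2 * pi * real (Suc k) * x) / real (Suc k) powr s))
            sums cos_part x m (of_real s)" .
  have "(\<lambda>k. (z ^ Suc k * of_real (-ln (real (Suc k))) ^ m * of_nat (Suc k) powr (-of_real s) -
              cnj z ^ Suc k * of_real (-ln (real (Suc k))) ^ m * of_nat (Suc k) powr (-of_real s)) / (2 * \<i>)) sums sin_part x m (of_real s)"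
    unfolding sin_part_def z_def[symmetric] by (intro sums_divide sums_diff sums z)
  also have "(\<lambda>k. (z ^ Suc k * of_real (-ln (real (Suc k))) ^ m * of_nat (Suc k) powr (-of_real s) -
              cnj z ^ Suc k * of_real (-ln (real (Suc k))) ^ m * of_nat (Suc k) powr (-of_real s)) / (2 * \<i>)) = 
     (\<lambda>k. complex_of_real ((-ln (real (Suc k))) ^ m * sin (2 * pi * real (Suc k) * x) / real (Suc k) powr s))"
  proof
    fix k
    define \<theta> where "\<theta> = 2 * pi * real (Suc k) * x"
    define l where "l = (-ln (real (Suc k))) ^ m"
    define p where "p = real (Suc k) powr s"
    show "(z ^ Suc k * of_real (-ln (real (Suc k))) ^ m * of_nat (Suc k) powr (-of_real s) -
              cnj z ^ Suc k * of_real (-ln (real (Suc k))) ^ m * of_nat (Suc k) powr (-of_real s)) / (2 * \<i>) = 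
       complex_of_real ((-ln (real (Suc k))) ^ m * sin (2 * pi * real (Suc k) * x) / real (Suc k) powr s)"
      unfolding zk zk' pw \<theta>_def[symmetric] p_def[symmetric] of_real_power[symmetric] l_def[symmetric]
      by (simp add: complex_eq_iff)
  qed
  finally show "(\<lambda>k. complex_of_real ((-ln (real (Suc k))) ^ m * sin (2 * pi * real (Suc k) * x) / real (Suc k) powr s))
            sums sin_part x m (of_real s)" .
qed

lemma of_real_suminf_eqI:
  assumes "(\<lambda>n. complex_of_real (f n)) sums c"
  shows   "of_real (suminf f) = c"
proof -
  have "f sums Re c" "(\<lambda>n. 0) sums Im c"
    using sums_Re[OF assms] sums_Im[OF assms] by simp_all
  hence "suminf f = Re c" "Im c = 0" by (auto simp: sums_iff)
  thus ?thesis by (simp add: complex_eq_iff)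
qed

text \<open>
  Expanding \<gamma> + log(2 pi n) = a + log n turns the three series into combinations of
  derivatives of the cosine and sine parts.  The outcome is the expression of deriv2_hurwitz_phi with s in
  place of 0.
\<close>

lemma gamma1_reg_eq:
  fixes x s :: real
  assumes x: "0 < x" "x < 1" and s: "s > 0"
  defines "a \<equiv> complex_of_real (euler_mascheroni + ln (2 * pi))"
  shows "gamma1_reg x s =
     (a\<^sup>2 * cos_part x 0 (of_real s) - 2 * a * cos_part x 1 (of_real s) + cos_part x 2 (of_real s))
     - 1 / 2 * of_real (pi\<^sup>2 / 6) * cos_part x 0 (of_real s)
     - of_real pi * (a * sin_part x 0 (of_real s) - sin_part x 1 (of_real s))"
proof -
  define n where "n = (\<lambda>k. real (Suc k))"
  define a' where "a' = euler_mascheroni + ln (2 * pi)"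
  have n: "n k > 0" for k by (simp add: n_def)
  have nS: "real (Suc k) = n k" for k by (simp add: n_def)
  have a: "a = of_real a'" by (simp add: a_def a'_def)
  have ln: "euler_mascheroni + ln (2 * pi * n k) = a' + ln (n k)" for k
    using n[of k] by (simp add: a'_def ln_mult)
  define c where "c = (\<lambda>m k. (-ln (n k)) ^ m * cos (2 * pi * n k * x) / n k powr s)"
  define d where "d = (\<lambda>m k. (-ln (n k)) ^ m * sin (2 * pi * n k * x) / n k powr s)"
  have c: "(\<lambda>k. complex_of_real (c m k)) sums cos_part x m (of_real s)" for m
    using trig_series_sums(1)[OF x s, of m] by (simp only: c_def nS)
  have d: "(\<lambda>k. complex_of_real (d m k)) sums sin_part x m (of_real s)" for m
    using trig_series_sums(2)[OF x s, of m] by (simp only: d_def nS)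
  have "of_real (cos_series x s) = cos_part x 0 (of_real s)"
    unfolding cos_series_def Let_def nS
    using c[of 0] by (intro of_real_suminf_eqI) (simp add: c_def)
  moreover have "of_real (cos_log_sq_series x s) =
       a\<^sup>2 * cos_part x 0 (of_real s) - 2 * a * cos_part x 1 (of_real s) + cos_part x 2 (of_real s)"
  proof -
    have "(\<lambda>k. a\<^sup>2 * of_real (c 0 k) - 2 * a * of_real (c 1 k) + of_real (c 2 k)) sums
            (a\<^sup>2 * cos_part x 0 (of_real s) - 2 * a * cos_part x 1 (of_real s) + cos_part x 2 (of_real s))"
      by (intro sums_add sums_diff sums_mult c)
    also have "(\<lambda>k. a\<^sup>2 * of_real (c 0 k) - 2 * a * of_real (c 1 k) + of_real (c 2 k)) = 
        (\<lambda>k. complex_of_real ((euler_mascheroni + ln (2 * pi * n k))\<^sup>2 * cos (2 * pi * n k * x) / n k powr s))"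
    proof
      fix k
      have "(a' + ln (n k))\<^sup>2 * cos (2 * pi * n k * x) / n k powr s = a'\<^sup>2 * c 0 k - 2 * a' * c 1 k + c 2 k"
        unfolding c_def by (simp add: add_divide_distrib power2_eq_square algebra_simps)
      thus "a\<^sup>2 * of_real (c 0 k) - 2 * a * of_real (c 1 k) + of_real (c 2 k) =
          complex_of_real ((euler_mascheroni + ln (2 * pi * n k))\<^sup>2 * cos (2 * pi * n k * x) / n k powr s)"
        unfolding ln a by simp
    qed
    finally show ?thesis
      unfolding cos_log_sq_series_def Let_def nS by (rule of_real_suminf_eqI)
  qed
  moreover have "of_real (sin_log_series x s) = a * sin_part x 0 (of_real s) - sin_part x 1 (of_real s)"
  proof -
    have "(\<lambda>k. a * of_real (d 0 k) - of_real (d 1 k)) sums (a * sin_part x 0 (of_real s) - sin_part x 1 (of_real s))"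
      by (intro sums_diff sums_mult d)
    also have "(\<lambda>k. a * of_real (d 0 k) - of_real (d 1 k)) = 
        (\<lambda>k. complex_of_real ((euler_mascheroni + ln (2 * pi * n k)) * sin (2 * pi * n k * x) / n k powr s))"
    proof
      fix k
      have "(a' + ln (n k)) * sin (2 * pi * n k * x) / n k powr s = a' * d 0 k - d 1 k"
        unfolding d_def by (simp add: add_divide_distrib algebra_simps)
      thus "a * of_real (d 0 k) - of_real (d 1 k) =
          complex_of_real ((euler_mascheroni + ln (2 * pi * n k)) * sin (2 * pi * n k * x) / n k powr s)"
        unfolding ln a by simp
    qed
    finally show ?thesis
      unfolding sin_log_series_def Let_def nS by (rule of_real_suminf_eqI)
  qed
  ultimately show ?thesis by (simp add: gamma1_reg_def riemann_zeta_2)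
qed

theorem mainTheorem1:
  fixes x :: real
  assumes "0 < x" and "x < 1"
  shows "(gamma1_reg x \<longlongrightarrow> stieltjes_gamma 1 x) (at_right 0)"
proof -
  define a where "a = complex_of_real (euler_mascheroni + ln (2 * pi))"
  define R where "R = (\<lambda>s. (a\<^sup>2 * cos_part x 0 s - 2 * a * cos_part x 1 s + cos_part x 2 s)
     - 1 / 2 * of_real (pi\<^sup>2 / 6) * cos_part x 0 s - of_real pi * (a * sin_part x 0 s - sin_part x 1 s))"
  have lim0: "((\<lambda>s. complex_of_real s) \<longlongrightarrow> 0) (at_right 0)"
    by (auto intro!: tendsto_eq_intros)
  have lim: "((\<lambda>s. cos_part x m (of_real s)) \<longlongrightarrow> cos_part x m 0) (at_right 0)"
    "((\<lambda>s. sin_part x m (of_real s)) \<longlongrightarrow> sin_part x m 0) (at_right 0)" for m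
    using isCont_cos_sin_part[OF assms] lim0 by (blast intro: isCont_tendsto_compose)+
  have "((\<lambda>s. R (of_real s)) \<longlongrightarrow> R 0) (at_right 0)"
    unfolding R_def by (intro tendsto_intros lim)
  moreover have "eventually (\<lambda>s. R (of_real s) = gamma1_reg x s) (at_right 0)"
    using eventually_at_right_less[of 0]
    by eventually_elim (use gamma1_reg_eq[OF assms] in \<open>simp add: R_def a_def\<close>)
  moreover have "R 0 = stieltjes_gamma 1 x"
    using stieltjes_gamma_1_eq[OF assms] deriv2_hurwitz_phi[OF assms] by (simp only: R_def a_def)
  ultimately show ?thesis using Lim_transform_eventually by force
qed

end
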